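(* Let $(M,L)$ be a Finsler manifold of nonzero (nowhere vanishing) scalar curvature $\kappa$. Let $f$ be an everywhere-nonzero smooth function on $\mathcal{T}M$ which is positively homogeneous of degree $r$ in the directional arguments, i.e. $f(\lambda u)=\lambda^r f(u)$ for all $\lambda>0$ and $u\in\mathcal{T}M$. If $\mathrm{grad}\,f$ is $\overline{d}$-closed, then there exists a smooth function $h$ on $M$ such that $f=(h\circ\pi)\,L^{r}$, i.e. $f(x,y)=h(x)L(x,y)^r$.
   Context: All objects are $C^\infty$. $M$ is an $n$-dimensional manifold, $\mathcal{T}M$ is the bundle of nonzero tangent vectors, $\pi:\mathcal{T}M\to M$ the projection, and $\pi^{-1}(TM)\to\mathcal{T}M$ the pullback of $TM$ by $\pi$. Its sections are called $\pi$-vector fields; tensor fields (forms) on $\pi^{-1}(TM)$ are called $\pi$-tensor fields ($\pi$-forms). A Finsler structure $L$ on $M$ is positive and smooth on $\mathcal{T}M$, positively homogeneous of degree 1 on fibres, and the fibrewise Hessian $g$ of $\frac12L^2$, a metric on $\pi^{-1}(TM)$ called the Finsler metric, is positive definite. The fundamental $\pi$-vector field is $\overline{\eta}(u)=(u,u)$. Let $\rho:T(\mathcal{T}M)\to\pi^{-1}(TM)$, $\rho(X)=(u,d\pi(X))$ for $X\in T_u(\mathcal{T}M)$, and $\gamma:\pi^{-1}(TM)\to T(\mathcal{T}M)$, $\gamma(u,v)=\frac{d}{dt}\big|_{t=0}(u+tv)$. For a linear connection $\nabla$ in $\pi^{-1}(TM)$, its connection map is $K(X)=\nabla_X\overline{\eta}$;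 $\nabla$ is regular if $T(\mathcal{T}M)=V(\mathcal{T}M)\oplus H(\mathcal{T}M)$, where $V(\mathcal TM)=\ker\rho$ and $H(\mathcal TM)=\ker K$. For regular $\nabla$ set $\beta=(\rho|_{H(\mathcal{T}M)})^{-1}$. The torsion is $\mathbf{T}(X,Y)=\nabla_X\rho Y-\nabla_Y\rho X-\rho[X,Y]$, with $Q(\overline{X},\overline{Y})=\mathbf{T}(\beta\overline{X},\beta\overline{Y})$ and $T(\overline{X},\overline{Y})=\mathbf{T}(\gamma\overline{X},\beta\overline{Y})$. The Cartan connection of $(M,L)$ is the unique regular connection $\nabla$ in $\pi^{-1}(TM)$ with $\nabla g=0$, $Q=0$ and $g(T(\overline{X},\overline{Y}),\overline{Z})=g(T(\overline{X},\overline{Z}),\overline{Y})$. Everything below refers to it. Its curvature is $\mathbf{K}(X,Y)\overline{Z}=-\nabla_X\nabla_Y\overline{Z}+\nabla_Y\nabla_X\overline{Z}+\nabla_{[X,Y]}\overline{Z}$; put $R(\overline{X},\overline{Y})\overline{Z}=\mathbf{K}(\beta\overline{X},\beta\overline{Y})\overline{Z}$ and $\widehat{R}(\overline{X},\overline{Y})=R(\overline{X},\overline{Y})\overline{\eta}$. $(M,L)$ is of scalar curvature $\kappa$ ($\kappa$ a function on $\mathcal{T}M$) if $\widehat{R}=\omega\wedge\phi$, i.e. $\widehat{R}(\overline{X},\overline{Y})=\omega(\overline{X})\phi(\overline{Y})-\omega(\overline{Y})\phi(\overline{X})$, where $\ell=L^{-1}i_{\overline{\eta}}g=dL\circ\gamma$,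 $\phi=I-L^{-1}\ell\otimes\overline{\eta}$ (so $\phi(\overline{X})=\overline{X}-L^{-1}\ell(\overline{X})\overline{\eta}$), and $\omega=\frac13L\,(L\,\overline{d}_J\kappa+3\kappa\,\ell)$ with $\overline{d}_J\kappa=d\kappa\circ\gamma$. For a function $f$ on $\mathcal{T}M$, $(\overline{d}f)(\overline{X})=\beta\overline{X}\cdot f$; for a 1-$\pi$-form $\theta$, $(\overline{d}\theta)(\overline{X},\overline{Y})=\beta\overline{X}\cdot\theta(\overline{Y})-\beta\overline{Y}\cdot\theta(\overline{X})-\theta(\rho[\beta\overline{X},\beta\overline{Y}])$. A $\pi$-vector field $\overline{X}$ is $\overline{d}$-closed if $\overline{d}(i_{\overline{X}}g)=0$, where $i_{\overline{X}}g=g(\overline{X},\cdot)$. The gradient of $f$ is the $\pi$-vector field $\overline{X}=\mathrm{grad}\,f$ with $i_{\overline{X}}g=\overline{d}f$.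
   Formalization: The scalar curvature κ is additionally required to be positively homogeneous of degree 0 in direction, and dim M ≥ 2; without these the claim fails (flat Minkowski space with κ = L^{-3}; one-dimensional M with different h on the two half-fibres). *)

theory Defs
  imports "HOL-Analysis.Analysis"
begin

subsection \<open>Smooth manifolds\<close>

text \<open>\<open>C\<^sup>\<infinity>\<close> maps on open subsets of normed spaces, through iterated directional derivatives.\<close>

fun Ck_on :: "nat \<Rightarrow> 'a::real_normed_vector set \<Rightarrow> ('a \<Rightarrow> 'b::real_normed_vector) \<Rightarrow> bool" where
  "Ck_on 0 S f \<longleftrightarrow> continuous_on S f"
| "Ck_on (Suc k) S f \<longleftrightarrow>
     (\<forall>x\<in>S. f differentiable (at x)) \<and> (\<forall>v. Ck_on k S (\<lambda>x. frechet_derivative f (at x) v))"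

definition smooth_on :: "'a::real_normed_vector set \<Rightarrow> ('a \<Rightarrow> 'b::real_normed_vector) \<Rightarrow> bool" where
  "smooth_on S f \<longleftrightarrow> open S \<and> (\<forall>k. Ck_on k S f)"

text \<open>
  A chart is a domain together with a coordinate map.  A charted space carries an atlas and a
  preferred chart at each point.  As \<open>c \<mapsto> (coordinates in c)\<close> is determined by its value in one
  chart, a tangent vector at \<open>p\<close> is represented by its coordinates in the preferred chart at
  \<open>p\<close>: every tangent space is the model space \<open>'e\<close>, and the tangent bundle is the set of pairs
  \<open>(p, v)\<close>.  Coordinates in any other chart are obtained with \<open>coords\<close> below.
\<close>

type_synonym ('a, 'e) chart = "'a set \<times> ('a \<Rightarrow> 'e)"

definition chart_image :: "('a, 'e) chart \<Rightarrow> 'e set" where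
  "chart_image c = snd c ` fst c"

definition chart_inv :: "('a, 'e) chart \<Rightarrow> 'e \<Rightarrow> 'a" where
  "chart_inv c = inv_into (fst c) (snd c)"

record ('a, 'e) charted_space =
  points :: "'a set"
  charts :: "('a, 'e) chart set"
  chart_at :: "'a \<Rightarrow> ('a, 'e) chart"

definition smooth_manifold ::
  "'a topology \<Rightarrow> ('a, 'e::euclidean_space) charted_space \<Rightarrow> bool" where
  "smooth_manifold X M \<longleftrightarrow>
     topspace X = points M \<and> Hausdorff_space X \<and> second_countable X \<and>
     (\<forall>c\<in>charts M. openin X (fst c) \<and> open (chart_image c) \<and>
        homeomorphic_map (subtopology X (fst c)) (top_of_set (chart_image c)) (snd c)) \<and>
     (\<forall>p\<in>points M. chart_at M p \<in> charts M \<and> p \<in> fst (chart_at M p)) \<and>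
     (\<forall>c\<in>charts M. \<forall>d\<in>charts M. smooth_on (snd c ` (fst c \<inter> fst d)) (snd d \<circ> chart_inv c))"

definition smooth_fun ::
  "('a, 'e::real_normed_vector) charted_space \<Rightarrow> ('a \<Rightarrow> 'b::real_normed_vector) \<Rightarrow> bool" where
  "smooth_fun M f \<longleftrightarrow> (\<forall>c\<in>charts M. smooth_on (chart_image c) (f \<circ> chart_inv c))"

text \<open>\<open>dir_deriv M f p v\<close> is \<open>v \<cdot> f\<close> for a tangent vector \<open>v\<close> at \<open>p\<close>.\<close>

definition dir_deriv ::
  "('a, 'e::real_normed_vector) charted_space \<Rightarrow> ('a \<Rightarrow> 'b::real_normed_vector) \<Rightarrow> 'a \<Rightarrow> 'e \<Rightarrow> 'b" where
  "dir_deriv M f p =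
     frechet_derivative (f \<circ> chart_inv (chart_at M p)) (at (snd (chart_at M p) p))"

text \<open>The coordinates in the chart \<open>c\<close> of the tangent vector \<open>v\<close> at \<open>p\<close>.\<close>

definition coords ::
  "('a, 'e::real_normed_vector) charted_space \<Rightarrow> ('a, 'e) chart \<Rightarrow> 'a \<Rightarrow> 'e \<Rightarrow> 'e" where
  "coords M c p v = dir_deriv M (snd c) p v"

definition tangent_map ::
  "('a, 'e::real_normed_vector) charted_space \<Rightarrow> ('b, 'd::real_normed_vector) charted_space
    \<Rightarrow> ('a \<Rightarrow> 'b) \<Rightarrow> 'a \<Rightarrow> 'e \<Rightarrow> 'd" where
  "tangent_map M N F p v = dir_deriv M (snd (chart_at N (F p)) \<circ> F) p v"

definition curve_velocity ::
  "('a, 'e::real_normed_vector) charted_space \<Rightarrow> (real \<Rightarrow> 'a) \<Rightarrow> real \<Rightarrow> 'e" where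
  "curve_velocity M \<sigma> t = vector_derivative (snd (chart_at M (\<sigma> t)) \<circ> \<sigma>) (at t)"

definition field_in_chart ::
  "('a, 'e::real_normed_vector) charted_space \<Rightarrow> ('a \<Rightarrow> 'e) \<Rightarrow> ('a, 'e) chart \<Rightarrow> 'e \<Rightarrow> 'e" where
  "field_in_chart M X c x = coords M c (chart_inv c x) (X (chart_inv c x))"

definition smooth_vector_field ::
  "('a, 'e::real_normed_vector) charted_space \<Rightarrow> ('a \<Rightarrow> 'e) \<Rightarrow> bool" where
  "smooth_vector_field M X \<longleftrightarrow> (\<forall>c\<in>charts M. smooth_on (chart_image c) (field_in_chart M X c))"

text \<open>
  In a chart, \<open>[X, Y]\<^sup>i = X\<^sup>j \<partial>\<^sub>j Y\<^sup>i - Y\<^sup>j \<partial>\<^sub>j X\<^sup>i\<close>; so \<open>[X, Y] \<cdot> f = X \<cdot> (Y \<cdot> f) - Y \<cdot> (X \<cdot> f)\<close>.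
\<close>

definition lie_bracket ::
  "('a, 'e::real_normed_vector) charted_space \<Rightarrow> ('a \<Rightarrow> 'e) \<Rightarrow> ('a \<Rightarrow> 'e) \<Rightarrow> 'a \<Rightarrow> 'e" where
  "lie_bracket M X Y p =
     (let c = chart_at M p; x = snd c p; X' = field_in_chart M X c; Y' = field_in_chart M Y c
      in frechet_derivative Y' (at x) (X' x) - frechet_derivative X' (at x) (Y' x))"

subsection \<open>The bundle of nonzero tangent vectors and the pullback bundle\<close>

definition slit_chart ::
  "('a, 'e::real_normed_vector) charted_space \<Rightarrow> ('a, 'e) chart \<Rightarrow> ('a \<times> 'e, 'e \<times> 'e) chart" where
  "slit_chart M c = ({(p, v). p \<in> fst c \<and> v \<noteq> 0}, \<lambda>(p, v). (snd c p, coords M c p v))"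

definition slit ::
  "('a, 'e::real_normed_vector) charted_space \<Rightarrow> ('a \<times> 'e, 'e \<times> 'e) charted_space" where
  "slit M = \<lparr>points = {(p, v). p \<in> points M \<and> v \<noteq> 0},
             charts = slit_chart M ` charts M,
             chart_at = (\<lambda>u. slit_chart M (chart_at M (fst u)))\<rparr>"

text \<open>
  The bundle projection \<open>\<pi>\<close> is \<open>fst\<close>.  The fibre of \<open>\<pi>\<^sup>-\<^sup>1(TM)\<close> over \<open>u\<close> is the tangent space of
  \<open>M\<close> at \<open>\<pi> u\<close>, and an element \<open>(u, v)\<close> of it is represented by \<open>v :: 'e\<close> over the known point
  \<open>u\<close>.  Hence a \<open>\<pi>\<close>-vector field is a function \<open>'a \<times> 'e \<Rightarrow> 'e\<close>, a 1-\<open>\<pi>\<close>-form is a function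
  \<open>'a \<times> 'e \<Rightarrow> 'e \<Rightarrow> real\<close>, and the tangent spaces of the slit bundle are \<open>'e \<times> 'e\<close>.
\<close>

type_synonym ('a, 'e) pi_field = "'a \<times> 'e \<Rightarrow> 'e"

definition smooth_pi_field ::
  "('a, 'e::real_normed_vector) charted_space \<Rightarrow> ('a, 'e) pi_field \<Rightarrow> bool" where
  "smooth_pi_field M Z \<longleftrightarrow>
     (\<forall>c\<in>charts M. smooth_on (chart_image (slit_chart M c))
        ((\<lambda>u. coords M c (fst u) (Z u)) \<circ> chart_inv (slit_chart M c)))"

definition eta :: "('a, 'e) pi_field" where
  "eta u = snd u"

definition rho :: "('a, 'e::real_normed_vector) charted_space \<Rightarrow> 'a \<times> 'e \<Rightarrow> 'e \<times> 'e \<Rightarrow> 'e" where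
  "rho M u \<xi> = tangent_map (slit M) M fst u \<xi>"

definition gam :: "('a, 'e::real_normed_vector) charted_space \<Rightarrow> 'a \<times> 'e \<Rightarrow> 'e \<Rightarrow> 'e \<times> 'e" where
  "gam M u v = curve_velocity (slit M) (\<lambda>t. (fst u, snd u + t *\<^sub>R v)) 0"

subsection \<open>Finsler structures\<close>

definition finsler_metric ::
  "('a \<times> 'e::real_normed_vector \<Rightarrow> real) \<Rightarrow> 'a \<times> 'e \<Rightarrow> 'e \<Rightarrow> 'e \<Rightarrow> real" where
  "finsler_metric L u v w =
     frechet_derivative
       (\<lambda>y. frechet_derivative (\<lambda>z. (L (fst u, z))\<^sup>2 / 2) (at y) w) (at (snd u)) v"

definition pos_homogeneous ::
  "('a, 'e::real_normed_vector) charted_space \<Rightarrow> real \<Rightarrow> ('a \<times> 'e \<Rightarrow> real) \<Rightarrow> bool" where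
  "pos_homogeneous M r f \<longleftrightarrow>
     (\<forall>u\<in>points (slit M). \<forall>t>0. f (fst u, t *\<^sub>R snd u) = t powr r * f u)"

definition finsler_structure ::
  "('a, 'e::real_normed_vector) charted_space \<Rightarrow> ('a \<times> 'e \<Rightarrow> real) \<Rightarrow> bool" where
  "finsler_structure M L \<longleftrightarrow>
     (\<forall>u\<in>points (slit M). L u > 0) \<and> smooth_fun (slit M) L \<and> pos_homogeneous M 1 L \<and>
     (\<forall>u\<in>points (slit M). \<forall>v. v \<noteq> 0 \<longrightarrow> finsler_metric L u v v > 0)"

subsection \<open>Linear connections in the pullback bundle\<close>

text \<open>
  \<open>D u \<xi> Z\<close> is \<open>\<nabla>\<^sub>\<xi> Z\<close> for a tangent vector \<open>\<xi>\<close> of the slit bundle at \<open>u\<close> and a \<open>\<pi>\<close>-vector field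
  \<open>Z\<close>; \<open>\<nabla>\<^sub>X Z\<close> for a vector field \<open>X\<close> is \<open>\<lambda>u. D u (X u) Z\<close>, so it is function-linear in \<open>X\<close> by
  construction.
\<close>

type_synonym ('a, 'e) pi_connection = "'a \<times> 'e \<Rightarrow> 'e \<times> 'e \<Rightarrow> ('a, 'e) pi_field \<Rightarrow> 'e"

definition linear_connection ::
  "('a, 'e::real_normed_vector) charted_space \<Rightarrow> ('a, 'e) pi_connection \<Rightarrow> bool" where
  "linear_connection M D \<longleftrightarrow>
     (\<forall>u\<in>points (slit M). \<forall>Z. smooth_pi_field M Z \<longrightarrow> linear (\<lambda>\<xi>. D u \<xi> Z)) \<and>
     (\<forall>u\<in>points (slit M). \<forall>\<xi> Z W. smooth_pi_field M Z \<longrightarrow> smooth_pi_field M W \<longrightarrow>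
        D u \<xi> (\<lambda>w. Z w + W w) = D u \<xi> Z + D u \<xi> W) \<and>
     (\<forall>u\<in>points (slit M). \<forall>\<xi> f Z. smooth_fun (slit M) f \<longrightarrow> smooth_pi_field M Z \<longrightarrow>
        D u \<xi> (\<lambda>w. f w *\<^sub>R Z w) = dir_deriv (slit M) f u \<xi> *\<^sub>R Z u + f u *\<^sub>R D u \<xi> Z) \<and>
     (\<forall>X Z. smooth_vector_field (slit M) X \<longrightarrow> smooth_pi_field M Z \<longrightarrow>
        smooth_pi_field M (\<lambda>u. D u (X u) Z))"

definition conn_map :: "('a, 'e) pi_connection \<Rightarrow> 'a \<times> 'e \<Rightarrow> 'e \<times> 'e \<Rightarrow> 'e" where
  "conn_map D u \<xi> = D u \<xi> eta"

definition vertical ::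
  "('a, 'e::real_normed_vector) charted_space \<Rightarrow> 'a \<times> 'e \<Rightarrow> ('e \<times> 'e) set" where
  "vertical M u = {\<xi>. rho M u \<xi> = 0}"

definition horizontal ::
  "('a, 'e::real_normed_vector) pi_connection \<Rightarrow> 'a \<times> 'e \<Rightarrow> ('e \<times> 'e) set" where
  "horizontal D u = {\<xi>. conn_map D u \<xi> = 0}"

definition regular_connection ::
  "('a, 'e::real_normed_vector) charted_space \<Rightarrow> ('a, 'e) pi_connection \<Rightarrow> bool" where
  "regular_connection M D \<longleftrightarrow>
     linear_connection M D \<and>
     (\<forall>u\<in>points (slit M). vertical M u \<inter> horizontal D u = {0} \<and>
        (\<forall>\<xi>. \<exists>v\<in>vertical M u. \<exists>h\<in>horizontal D u. \<xi> = v + h))"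

definition beta ::
  "('a, 'e::real_normed_vector) charted_space \<Rightarrow> ('a, 'e) pi_connection
    \<Rightarrow> 'a \<times> 'e \<Rightarrow> 'e \<Rightarrow> 'e \<times> 'e" where
  "beta M D u = inv_into (horizontal D u) (rho M u)"

definition torsion ::
  "('a, 'e::real_normed_vector) charted_space \<Rightarrow> ('a, 'e) pi_connection
    \<Rightarrow> ('a \<times> 'e \<Rightarrow> 'e \<times> 'e) \<Rightarrow> ('a \<times> 'e \<Rightarrow> 'e \<times> 'e) \<Rightarrow> ('a, 'e) pi_field" where
  "torsion M D X Y u =
     D u (X u) (\<lambda>w. rho M w (Y w)) - D u (Y u) (\<lambda>w. rho M w (X w))
     - rho M u (lie_bracket (slit M) X Y u)"

definition h_torsion ::
  "('a, 'e::real_normed_vector) charted_space \<Rightarrow> ('a, 'e) pi_connection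
    \<Rightarrow> ('a, 'e) pi_field \<Rightarrow> ('a, 'e) pi_field \<Rightarrow> ('a, 'e) pi_field" where
  "h_torsion M D X Y = torsion M D (\<lambda>u. beta M D u (X u)) (\<lambda>u. beta M D u (Y u))"

definition hv_torsion ::
  "('a, 'e::real_normed_vector) charted_space \<Rightarrow> ('a, 'e) pi_connection
    \<Rightarrow> ('a, 'e) pi_field \<Rightarrow> ('a, 'e) pi_field \<Rightarrow> ('a, 'e) pi_field" where
  "hv_torsion M D X Y = torsion M D (\<lambda>u. gam M u (X u)) (\<lambda>u. beta M D u (Y u))"

definition cartan_connection ::
  "('a, 'e::real_normed_vector) charted_space \<Rightarrow> ('a \<times> 'e \<Rightarrow> real) \<Rightarrow> ('a, 'e) pi_connection \<Rightarrow> bool" where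
  "cartan_connection M L D \<longleftrightarrow>
     regular_connection M D \<and>
     (\<forall>u\<in>points (slit M). \<forall>\<xi> Z W. smooth_pi_field M Z \<longrightarrow> smooth_pi_field M W \<longrightarrow>
        dir_deriv (slit M) (\<lambda>w. finsler_metric L w (Z w) (W w)) u \<xi> =
          finsler_metric L u (D u \<xi> Z) (W u) + finsler_metric L u (Z u) (D u \<xi> W)) \<and>
     (\<forall>u\<in>points (slit M). \<forall>X Y. smooth_pi_field M X \<longrightarrow> smooth_pi_field M Y \<longrightarrow>
        h_torsion M D X Y u = 0) \<and>
     (\<forall>u\<in>points (slit M). \<forall>X Y Z.
        smooth_pi_field M X \<longrightarrow> smooth_pi_field M Y \<longrightarrow> smooth_pi_field M Z \<longrightarrow>
        finsler_metric L u (hv_torsion M D X Y u) (Z u) =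
          finsler_metric L u (hv_torsion M D X Z u) (Y u))"

subsection \<open>Curvature and scalar curvature\<close>

definition curvature ::
  "('a, 'e::real_normed_vector) charted_space \<Rightarrow> ('a, 'e) pi_connection
    \<Rightarrow> ('a \<times> 'e \<Rightarrow> 'e \<times> 'e) \<Rightarrow> ('a \<times> 'e \<Rightarrow> 'e \<times> 'e) \<Rightarrow> ('a, 'e) pi_field \<Rightarrow> ('a, 'e) pi_field" where
  "curvature M D X Y Z u =
     - D u (X u) (\<lambda>w. D w (Y w) Z) + D u (Y u) (\<lambda>w. D w (X w) Z)
     + D u (lie_bracket (slit M) X Y u) Z"

definition h_curvature ::
  "('a, 'e::real_normed_vector) charted_space \<Rightarrow> ('a, 'e) pi_connection
    \<Rightarrow> ('a, 'e) pi_field \<Rightarrow> ('a, 'e) pi_field \<Rightarrow> ('a, 'e) pi_field \<Rightarrow> ('a, 'e) pi_field" where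
  "h_curvature M D X Y Z =
     curvature M D (\<lambda>u. beta M D u (X u)) (\<lambda>u. beta M D u (Y u)) Z"

definition R_hat ::
  "('a, 'e::real_normed_vector) charted_space \<Rightarrow> ('a, 'e) pi_connection
    \<Rightarrow> ('a, 'e) pi_field \<Rightarrow> ('a, 'e) pi_field \<Rightarrow> ('a, 'e) pi_field" where
  "R_hat M D X Y = h_curvature M D X Y eta"

definition ell :: "('a \<times> 'e::real_normed_vector \<Rightarrow> real) \<Rightarrow> 'a \<times> 'e \<Rightarrow> 'e \<Rightarrow> real" where
  "ell L u v = inverse (L u) * finsler_metric L u (eta u) v"

definition phi :: "('a \<times> 'e::real_normed_vector \<Rightarrow> real) \<Rightarrow> 'a \<times> 'e \<Rightarrow> 'e \<Rightarrow> 'e" where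
  "phi L u v = v - (inverse (L u) * ell L u v) *\<^sub>R eta u"

definition d_J ::
  "('a, 'e::real_normed_vector) charted_space \<Rightarrow> ('a \<times> 'e \<Rightarrow> real) \<Rightarrow> 'a \<times> 'e \<Rightarrow> 'e \<Rightarrow> real" where
  "d_J M f u v = dir_deriv (slit M) f u (gam M u v)"

definition omega ::
  "('a, 'e::real_normed_vector) charted_space \<Rightarrow> ('a \<times> 'e \<Rightarrow> real) \<Rightarrow> ('a \<times> 'e \<Rightarrow> real)
    \<Rightarrow> 'a \<times> 'e \<Rightarrow> 'e \<Rightarrow> real" where
  "omega M L \<kappa> u v = 1 / 3 * L u * (L u * d_J M \<kappa> u v + 3 * \<kappa> u * ell L u v)"

text \<open>
  As usual in Finsler geometry, the scalar curvature is a function of position and direction,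
  that is, positively homogeneous of degree 0.  This has to be said because the equation
  \<open>R\<^sub>h\<^sub>a\<^sub>t = \<omega> \<and> \<phi>\<close> alone does not determine \<open>\<kappa>\<close>: replacing \<open>\<kappa>\<close> by \<open>\<kappa> + a L\<^sup>-\<^sup>3\<close>, with \<open>a\<close> a
  function on \<open>M\<close>, leaves \<open>\<omega>\<close> unchanged, so that even a flat space would satisfy it with the
  nowhere vanishing function \<open>\<kappa> = L\<^sup>-\<^sup>3\<close>.
\<close>

definition scalar_curvature ::
  "('a, 'e::real_normed_vector) charted_space \<Rightarrow> ('a \<times> 'e \<Rightarrow> real) \<Rightarrow> ('a, 'e) pi_connection
    \<Rightarrow> ('a \<times> 'e \<Rightarrow> real) \<Rightarrow> bool" where
  "scalar_curvature M L D \<kappa> \<longleftrightarrow>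
     smooth_fun (slit M) \<kappa> \<and> pos_homogeneous M 0 \<kappa> \<and>
     (\<forall>X Y. smooth_pi_field M X \<longrightarrow> smooth_pi_field M Y \<longrightarrow>
        (\<forall>u\<in>points (slit M). R_hat M D X Y u =
           omega M L \<kappa> u (X u) *\<^sub>R phi L u (Y u) - omega M L \<kappa> u (Y u) *\<^sub>R phi L u (X u)))"

subsection \<open>Horizontal exterior derivative and gradient\<close>

definition dbar_fun ::
  "('a, 'e::real_normed_vector) charted_space \<Rightarrow> ('a, 'e) pi_connection
    \<Rightarrow> ('a \<times> 'e \<Rightarrow> real) \<Rightarrow> 'a \<times> 'e \<Rightarrow> 'e \<Rightarrow> real" where
  "dbar_fun M D f u v = dir_deriv (slit M) f u (beta M D u v)"

definition dbar_form ::
  "('a, 'e::real_normed_vector) charted_space \<Rightarrow> ('a, 'e) pi_connection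
    \<Rightarrow> ('a \<times> 'e \<Rightarrow> 'e \<Rightarrow> real) \<Rightarrow> ('a, 'e) pi_field \<Rightarrow> ('a, 'e) pi_field \<Rightarrow> 'a \<times> 'e \<Rightarrow> real" where
  "dbar_form M D \<theta> X Y u =
     dir_deriv (slit M) (\<lambda>w. \<theta> w (Y w)) u (beta M D u (X u))
     - dir_deriv (slit M) (\<lambda>w. \<theta> w (X w)) u (beta M D u (Y u))
     - \<theta> u (rho M u
         (lie_bracket (slit M) (\<lambda>w. beta M D w (X w)) (\<lambda>w. beta M D w (Y w)) u))"

definition dbar_closed ::
  "('a, 'e::real_normed_vector) charted_space \<Rightarrow> ('a \<times> 'e \<Rightarrow> real) \<Rightarrow> ('a, 'e) pi_connection
    \<Rightarrow> ('a, 'e) pi_field \<Rightarrow> bool" where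
  "dbar_closed M L D Z \<longleftrightarrow>
     (\<forall>X Y. smooth_pi_field M X \<longrightarrow> smooth_pi_field M Y \<longrightarrow>
        (\<forall>u\<in>points (slit M). dbar_form M D (\<lambda>w. finsler_metric L w (Z w)) X Y u = 0))"

definition grad ::
  "('a, 'e::real_normed_vector) charted_space \<Rightarrow> ('a \<times> 'e \<Rightarrow> real) \<Rightarrow> ('a, 'e) pi_connection
    \<Rightarrow> ('a \<times> 'e \<Rightarrow> real) \<Rightarrow> ('a, 'e) pi_field" where
  "grad M L D f u = (THE v. \<forall>w. finsler_metric L u v w = dbar_fun M D f u w)"

end

theory Submission
  imports Defs
begin

text \<open>
  For the Cartan connection, \<open>K (\<gamma> X) = X\<close>, so the vertical part of \<open>[\<beta>X, \<beta>Y]\<close> is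
  \<open>\<gamma> (K [\<beta>X, \<beta>Y]) = \<gamma> (R\<^sub>h\<^sub>a\<^sub>t (X, Y))\<close>.  Hence \<open>dbar (dbar f) (X, Y) = \<gamma> (R\<^sub>h\<^sub>a\<^sub>t (X, Y)) \<cdot> f\<close>, and this
  vanishes when \<open>grad f\<close> is closed.  For \<open>X = \<eta>\<close> scalar curvature gives
  \<open>R\<^sub>h\<^sub>a\<^sub>t (\<eta>, Y) = \<kappa> L\<^sup>2 \<phi> (Y)\<close>, so the fibre derivative of \<open>f\<close> is a multiple of \<open>dL\<close>.  By Euler's
  theorem the multiple is \<open>r f / L\<close>, that is, \<open>f L\<^sup>-\<^sup>r\<close> has vanishing derivative on the fibres, which are
  connected.  Cutoff functions make the tensorial identities, known for global fields only,
  available pointwise.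
\<close>

subsection \<open>Smooth maps between open subsets of Euclidean spaces\<close>

text \<open>\<open>D\<close> is an abstract operator on globally smooth \<open>\<pi>\<close>-fields,
  without connection coefficients, and no hypothesis says that \<open>\<beta>X\<close> varies
  smoothly with the point. Yet \<open>lie_bracket\<close> is built from Frechet derivatives of
  coordinate expressions, so the Ricci identity requires \<open>\<beta>X\<close> to be
  differentiable. The inverse function theorem yields this from the linear system that determines
  \<open>\<beta>X\<close> in a chart. One derivative is enough: the bracket identity differentiates
  each field once and only \<open>f\<close> twice. \<open>K (\<gamma> X) = X\<close> is not built in
  either: regularity makes \<open>K\<close> injective on vertical vectors and no more. It follows
  from metricity and the symmetry of the mixed torsion, both evaluated with \<open>\<eta>\<close> as
  one argument, where \<open>g(\<eta>, .)\<close> is the fibre differential of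
  \<open>L\<^sup>2 / 2\<close>. Degree 0 of \<open>\<kappa>\<close> gives
  \<open>d_J \<kappa> (\<eta>) = 0\<close>, which turns \<open>\<omega>(\<eta>)\<close> into the
  nonvanishing factor \<open>\<kappa> L\<^sup>2\<close>. Dimension at least 2 is what makes a fibre
  without its origin connected.\<close>

lemma linear_basis_expansion:
  fixes h :: "'a::euclidean_space \<Rightarrow> 'b::real_vector"
  assumes "linear h"
  shows "h v = (\<Sum>i\<in>Basis. (v \<bullet> i) *\<^sub>R h i)"
proof -
  have "h v = h (\<Sum>i\<in>Basis. (v \<bullet> i) *\<^sub>R i)"
    by (simp add: euclidean_representation)
  also have "\<dots> = (\<Sum>i\<in>Basis. (v \<bullet> i) *\<^sub>R h i)"
    by (simp add: linear_sum[OF assms] linear_cmul[OF assms])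
  finally show ?thesis .
qed

lemma frechet_derivative_eqI:
  "(f has_derivative f') (at x) \<Longrightarrow> frechet_derivative f (at x) = f'"
  using frechet_derivative_at by metis

lemma frechet_derivativeD:
  "f differentiable (at x) \<Longrightarrow> (f has_derivative frechet_derivative f (at x)) (at x)"
  by (simp add: frechet_derivative_works)

text \<open>No differentiability is assumed: \<open>frechet_derivative\<close> is a choice over the
  predicate \<open>has_derivative\<close>, and these predicates coincide for functions that agree
  near \<open>x\<close>, so the same value is chosen.\<close>

lemma frechet_derivative_cong_open:
  assumes "open S" "x \<in> S" "\<And>y. y \<in> S \<Longrightarrow> f y = g y"
  shows "frechet_derivative f (at x) = frechet_derivative g (at x)"
proof -
  have "(f has_derivative f') (at x) \<longleftrightarrow> (g has_derivative f') (at x)" for f'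
    using has_derivative_transform_within_open[OF _ assms(1,2)] assms(3)
    by metis
  then show ?thesis
    by (simp add: frechet_derivative_def)
qed

lemma differentiable_cong_open:
  assumes "open S" "x \<in> S" "\<And>y. y \<in> S \<Longrightarrow> f y = g y"
  shows "f differentiable (at x) \<longleftrightarrow> g differentiable (at x)"
  using has_derivative_transform_within_open[OF _ assms(1,2)] assms(3)
  unfolding differentiable_def by metis

lemma Ck_on_cong:
  assumes "open S" "\<And>x. x \<in> S \<Longrightarrow> f x = g x" "Ck_on k S f"
  shows "Ck_on k S g"
  using assms(2,3)
proof (induction k arbitrary: f g)
  case 0
  then show ?case using continuous_on_cong[OF refl, of S f g] by simp
next
  case (Suc k)
  have "g differentiable (at x)" if "x \<in> S" for x
    using Suc.prems that differentiable_cong_open[OF assms(1) that, of f g] by simp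
  moreover have "Ck_on k S (\<lambda>x. frechet_derivative g (at x) v)" for v
  proof (rule Suc.IH)
    show "frechet_derivative f (at x) v = frechet_derivative g (at x) v" if "x \<in> S" for x
      using frechet_derivative_cong_open[OF assms(1) that Suc.prems(1)] by simp
  qed (use Suc.prems in simp)
  ultimately show ?case by simp
qed

lemma Ck_on_subset: "Ck_on k S f \<Longrightarrow> T \<subseteq> S \<Longrightarrow> Ck_on k T f"
  by (induction k arbitrary: f) (auto intro: continuous_on_subset)

lemma Ck_on_differentiable: "Ck_on (Suc k) S f \<Longrightarrow> x \<in> S \<Longrightarrow> f differentiable (at x)"
  by simp

lemma Ck_on_SucD: "Ck_on (Suc k) S f \<Longrightarrow> Ck_on k S f"
proof (induction k arbitrary: f)
  case 0
  then show ?case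
    by (auto intro!: continuous_at_imp_continuous_on differentiable_imp_continuous_within)
next
  case (Suc k)
  then show ?case by (metis Ck_on.simps(2))
qed

lemma Ck_on_UN:
  assumes "\<And>x. x \<in> S \<Longrightarrow> \<exists>U. open U \<and> x \<in> U \<and> Ck_on k U f"
  shows "Ck_on k S f"
  using assms
proof (induction k arbitrary: f)
  case 0
  then show ?case
    by (meson Ck_on.simps(1) continuous_at_imp_continuous_on continuous_on_eq_continuous_at)
next
  case (Suc k)
  have "f differentiable (at x)" if "x \<in> S" for x
    using Suc.prems[OF that] by auto
  moreover have "Ck_on k S (\<lambda>x. frechet_derivative f (at x) v)" for v
    by (rule Suc.IH) (use Suc.prems in fastforce)
  ultimately show ?case by simp
qed

lemma Ck_on_const: "Ck_on k S (\<lambda>x. c)"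
proof (induction k arbitrary: c)
  case (Suc k)
  show ?case using Suc[of 0] by simp
qed simp

lemma Ck_on_linear:
  assumes "bounded_linear h"
  shows "Ck_on k S h"
proof (cases k)
  case 0
  then show ?thesis by (simp add: assms linear_continuous_on)
next
  case (Suc m)
  have "frechet_derivative h (at x) = h" for x
    by (intro frechet_derivative_eqI bounded_linear_imp_has_derivative assms)
  then show ?thesis
    using assms Suc by (auto simp: Ck_on_const bounded_linear_imp_differentiable)
qed

lemma Ck_on_linear_comp:
  assumes "bounded_linear h" "open S" "Ck_on k S f"
  shows "Ck_on k S (\<lambda>x. h (f x))"
  using assms(3)
proof (induction k arbitrary: f)
  case 0
  then show ?case
    by (simp add: assms(1) bounded_linear.continuous_on)
next
  case (Suc k)
  have D: "((\<lambda>x. h (f x)) has_derivative (\<lambda>v. h (frechet_derivative f (at x) v))) (at x)"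
    if "x \<in> S" for x
    using Suc.prems that by (intro bounded_linear.has_derivative[OF assms(1)] frechet_derivativeD) auto
  have "Ck_on k S (\<lambda>x. frechet_derivative (\<lambda>x. h (f x)) (at x) v)" for v
    by (rule Ck_on_cong[OF assms(2) _ Suc.IH[of "\<lambda>x. frechet_derivative f (at x) v"]])
      (use Suc.prems in \<open>auto simp: frechet_derivative_eqI[OF D]\<close>)
  then show ?case
    using D by (auto simp: differentiable_def)
qed

lemma Ck_on_add:
  assumes "open S" "Ck_on k S f" "Ck_on k S g"
  shows "Ck_on k S (\<lambda>x. f x + g x)"
  using assms(2,3)
proof (induction k arbitrary: f g)
  case 0
  then show ?case by (simp add: continuous_on_add)
next
  case (Suc k)
  have D: "((\<lambda>x. f x + g x) has_derivative
      (\<lambda>v. frechet_derivative f (at x) v + frechet_derivative g (at x) v)) (at x)"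
    if "x \<in> S" for x
    using Suc.prems that by (intro has_derivative_add frechet_derivativeD) auto
  have "Ck_on k S (\<lambda>x. frechet_derivative (\<lambda>x. f x + g x) (at x) v)" for v
    by (rule Ck_on_cong[OF assms(1) _ Suc.IH[of "\<lambda>x. frechet_derivative f (at x) v"
            "\<lambda>x. frechet_derivative g (at x) v"]])
      (use Suc.prems in \<open>auto simp: frechet_derivative_eqI[OF D]\<close>)
  then show ?case
    using D by (auto simp: differentiable_def)
qed

lemma Ck_on_sum:
  assumes "open S" "\<And>i. i \<in> I \<Longrightarrow> Ck_on k S (f i)"
  shows "Ck_on k S (\<lambda>x. \<Sum>i\<in>I. f i x)"
  using assms(2)
  by (induction I rule: infinite_finite_induct) (auto simp: Ck_on_const Ck_on_add assms(1))

lemma Ck_on_scaleR: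
  fixes f :: "'a::real_normed_vector \<Rightarrow> real" and g :: "'a \<Rightarrow> 'b::real_normed_vector"
  assumes "open S" "Ck_on k S f" "Ck_on k S g"
  shows "Ck_on k S (\<lambda>x. f x *\<^sub>R g x)"
  using assms(2,3)
proof (induction k arbitrary: f g)
  case 0
  then show ?case by (simp add: continuous_on_scaleR)
next
  case (Suc k)
  have D: "((\<lambda>x. f x *\<^sub>R g x) has_derivative
      (\<lambda>v. f x *\<^sub>R frechet_derivative g (at x) v + frechet_derivative f (at x) v *\<^sub>R g x)) (at x)"
    if "x \<in> S" for x
    using Suc.prems that by (intro has_derivative_scaleR frechet_derivativeD) auto
  have "Ck_on k S (\<lambda>x. frechet_derivative (\<lambda>x. f x *\<^sub>R g x) (at x) v)" for v
  proof (rule Ck_on_cong[OF assms(1)])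
    show "f x *\<^sub>R frechet_derivative g (at x) v + frechet_derivative f (at x) v *\<^sub>R g x
        = frechet_derivative (\<lambda>x. f x *\<^sub>R g x) (at x) v" if "x \<in> S" for x
      by (simp add: frechet_derivative_eqI[OF D[OF that]])
    show "Ck_on k S (\<lambda>x. f x *\<^sub>R frechet_derivative g (at x) v + frechet_derivative f (at x) v *\<^sub>R g x)"
      using Suc.prems Suc.prems[THEN Ck_on_SucD]
      by (intro Ck_on_add assms(1) Suc.IH) auto
  qed
  then show ?case
    using D by (auto simp: differentiable_def)
qed

text \<open>The chain rule produces a derivative of \<open>g\<close> at a moving point applied to a
  moving vector. Expanding that vector in \<open>Basis\<close> leaves the maps
  \<open>y \<mapsto> frechet_derivative g (at y) i\<close> with \<open>i\<close> fixed, to which the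
  induction hypothesis, general in \<open>g\<close>, applies.\<close>

lemma Ck_on_compose:
  fixes f :: "'a::real_normed_vector \<Rightarrow> 'b::euclidean_space" and g :: "'b \<Rightarrow> 'c::real_normed_vector"
  assumes "open S" "open T" "f ` S \<subseteq> T" "Ck_on k S f" "Ck_on k T g"
  shows "Ck_on k S (\<lambda>x. g (f x))"
  using assms(4,5)
proof (induction k arbitrary: g)
  case 0
  show ?case
    using continuous_on_compose2[OF 0(2,1)[unfolded Ck_on.simps] assms(3)]
    unfolding Ck_on.simps .
next
  case (Suc k)
  have D: "((\<lambda>x. g (f x)) has_derivative
      (\<lambda>v. frechet_derivative g (at (f x)) (frechet_derivative f (at x) v))) (at x)"
    if "x \<in> S" for x
    using Suc.prems that assms(3)
    by (intro has_derivative_compose[OF frechet_derivativeD frechet_derivativeD]) auto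
  have "Ck_on k S (\<lambda>x. frechet_derivative (\<lambda>x. g (f x)) (at x) v)" for v
  proof (rule Ck_on_cong[OF assms(1)])
    show "(\<Sum>i\<in>Basis. (frechet_derivative f (at x) v \<bullet> i) *\<^sub>R frechet_derivative g (at (f x)) i)
        = frechet_derivative (\<lambda>x. g (f x)) (at x) v" if "x \<in> S" for x
      using Suc.prems that assms(3)
      by (subst frechet_derivative_eqI[OF D[OF that]],
          subst linear_basis_expansion[of "frechet_derivative g (at (f x))"])
        (auto intro!: linear_frechet_derivative)
    show "Ck_on k S (\<lambda>x. \<Sum>i\<in>Basis. (frechet_derivative f (at x) v \<bullet> i) *\<^sub>R frechet_derivative g (at (f x)) i)"
      using Suc.prems Ck_on_SucD[OF Suc.prems(1)]
      by (intro Ck_on_sum Ck_on_scaleR assms(1) Suc.IH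
          Ck_on_linear_comp[OF bounded_linear_inner_left assms(1), of _ "\<lambda>x. frechet_derivative f (at x) v"]) auto
  qed
  then show ?case
    using D by (auto simp: differentiable_def)
qed

lemma smooth_onI: "open S \<Longrightarrow> (\<And>k. Ck_on k S f) \<Longrightarrow> smooth_on S f"
  by (simp add: smooth_on_def)

lemma smooth_on_open: "smooth_on S f \<Longrightarrow> open S"
  by (simp add: smooth_on_def)

lemma smooth_on_Ck: "smooth_on S f \<Longrightarrow> Ck_on k S f"
  by (simp add: smooth_on_def)

lemma smooth_on_cong:
  assumes "smooth_on S f" "\<And>x. x \<in> S \<Longrightarrow> f x = g x"
  shows "smooth_on S g"
  by (rule smooth_onI[OF smooth_on_open[OF assms(1)]],
      rule Ck_on_cong[OF smooth_on_open[OF assms(1)] assms(2) smooth_on_Ck[OF assms(1)]])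

lemma smooth_on_subset:
  assumes "smooth_on S f" "open T" "T \<subseteq> S"
  shows "smooth_on T f"
  by (rule smooth_onI[OF assms(2)], rule Ck_on_subset[OF smooth_on_Ck[OF assms(1)] assms(3)])

lemma smooth_on_differentiable: "smooth_on S f \<Longrightarrow> x \<in> S \<Longrightarrow> f differentiable (at x)"
  by (rule Ck_on_differentiable[OF smooth_on_Ck])

lemma smooth_on_derivative:
  assumes "smooth_on S f"
  shows "smooth_on S (\<lambda>x. frechet_derivative f (at x) v)"
  by (rule smooth_onI[OF smooth_on_open[OF assms]])
    (use smooth_on_Ck[OF assms, of "Suc _"] in simp)

lemma smooth_on_Un:
  assumes "smooth_on S f" "smooth_on T f"
  shows "smooth_on (S \<union> T) f"
proof (rule smooth_onI)
  show "open (S \<union> T)"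
    by (intro open_Un smooth_on_open[OF assms(1)] smooth_on_open[OF assms(2)])
  show "Ck_on k (S \<union> T) f" for k
  proof (rule Ck_on_UN)
    fix x assume "x \<in> S \<union> T"
    then show "\<exists>U. open U \<and> x \<in> U \<and> Ck_on k U f"
      using smooth_on_open[OF assms(1)] smooth_on_open[OF assms(2)]
        smooth_on_Ck[OF assms(1), of k] smooth_on_Ck[OF assms(2), of k] by (elim UnE) metis+
  qed
qed

lemma smooth_on_const: "open S \<Longrightarrow> smooth_on S (\<lambda>x. c)"
  by (simp add: Ck_on_const smooth_on_def)

lemma smooth_on_linear: "open S \<Longrightarrow> bounded_linear h \<Longrightarrow> smooth_on S h"
  by (simp add: Ck_on_linear smooth_on_def)

lemma smooth_on_linear_comp:
  assumes "bounded_linear h" "smooth_on S f"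
  shows "smooth_on S (\<lambda>x. h (f x))"
  using Ck_on_linear_comp[OF assms(1), of S _ f] assms(2) by (simp add: smooth_on_def)

lemma smooth_on_add: "smooth_on S f \<Longrightarrow> smooth_on S g \<Longrightarrow> smooth_on S (\<lambda>x. f x + g x)"
  by (rule smooth_onI[OF smooth_on_open Ck_on_add[OF smooth_on_open smooth_on_Ck smooth_on_Ck]])

lemma smooth_on_sum:
  "open S \<Longrightarrow> (\<And>i. i \<in> I \<Longrightarrow> smooth_on S (f i)) \<Longrightarrow> smooth_on S (\<lambda>x. \<Sum>i\<in>I. f i x)"
  by (rule smooth_onI[OF _ Ck_on_sum[OF _ smooth_on_Ck]])

lemma smooth_on_scaleR:
  fixes f :: "'a::real_normed_vector \<Rightarrow> real" and g :: "'a \<Rightarrow> 'b::real_normed_vector"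
  shows "smooth_on S f \<Longrightarrow> smooth_on S g \<Longrightarrow> smooth_on S (\<lambda>x. f x *\<^sub>R g x)"
  by (rule smooth_onI[OF smooth_on_open Ck_on_scaleR[OF smooth_on_open smooth_on_Ck smooth_on_Ck]])

lemma smooth_on_compose:
  fixes f :: "'a::real_normed_vector \<Rightarrow> 'b::euclidean_space" and g :: "'b \<Rightarrow> 'c::real_normed_vector"
  shows "smooth_on S f \<Longrightarrow> smooth_on T g \<Longrightarrow> f ` S \<subseteq> T \<Longrightarrow> smooth_on S (\<lambda>x. g (f x))"
  by (rule smooth_onI[OF smooth_on_open
        Ck_on_compose[OF smooth_on_open smooth_on_open _ smooth_on_Ck smooth_on_Ck]])

lemma smooth_on_Pair:
  fixes f :: "'a::real_normed_vector \<Rightarrow> 'b::real_normed_vector" and g :: "'a \<Rightarrow> 'c::real_normed_vector"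
  assumes "smooth_on S f" "smooth_on S g"
  shows "smooth_on S (\<lambda>x. (f x, g x))"
proof -
  have "bounded_linear (\<lambda>x::'b. (x, 0::'c))" "bounded_linear (\<lambda>x::'c. (0::'b, x))"
    by (intro bounded_linear_Pair bounded_linear_ident bounded_linear_zero)+
  then have "smooth_on S (\<lambda>x. (f x, 0) + (0, g x))"
    using smooth_on_add[OF smooth_on_linear_comp[OF _ assms(1)] smooth_on_linear_comp[OF _ assms(2)]]
    by blast
  then show ?thesis by simp
qed

lemma smooth_on_linear_family:
  fixes F :: "'a::real_normed_vector \<Rightarrow> 'b::euclidean_space \<Rightarrow> 'c::real_normed_vector"
  assumes "\<And>v. smooth_on S (\<lambda>x. F x v)" "\<And>x. x \<in> S \<Longrightarrow> linear (F x)" "smooth_on S w"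
  shows "smooth_on S (\<lambda>x. F x (w x))"
proof (rule smooth_on_cong)
  show "smooth_on S (\<lambda>x. \<Sum>i\<in>Basis. (w x \<bullet> i) *\<^sub>R F x i)"
    by (intro smooth_on_sum smooth_on_scaleR smooth_on_open[OF assms(3)] assms(1)
          smooth_on_linear_comp[OF bounded_linear_inner_left assms(3)])
qed (use assms linear_basis_expansion in metis)

text \<open>Product rule for evaluation. Only the columns, with \<open>v\<close> fixed, are assumed
  differentiable; expanding \<open>w x\<close> in \<open>Basis\<close> turns the expression into a
  finite sum of scalar multiples.\<close>

lemma has_derivative_linear_family:
  fixes F :: "'a::real_normed_vector \<Rightarrow> 'b::euclidean_space \<Rightarrow> 'c::real_normed_vector"
  assumes "open S" "x \<in> S" "\<And>v. (\<lambda>x. F x v) differentiable (at x)"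
    "\<And>x. x \<in> S \<Longrightarrow> linear (F x)" "(w has_derivative w') (at x)"
  shows "((\<lambda>x. F x (w x)) has_derivative
    (\<lambda>h. frechet_derivative (\<lambda>y. F y (w x)) (at x) h + F x (w' h))) (at x)"
proof -
  let ?D = "\<lambda>i. frechet_derivative (\<lambda>y. F y i) (at x)"
  have wi: "((\<lambda>x. w x \<bullet> i) has_derivative (\<lambda>h. w' h \<bullet> i)) (at x)" for i
    using assms(5) by (rule has_derivative_inner_left)
  have F: "((\<lambda>y. F y i) has_derivative ?D i) (at x)" for i
    using assms(3) frechet_derivativeD by blast
  have a: "((\<lambda>x. \<Sum>i\<in>Basis. (w x \<bullet> i) *\<^sub>R F x i) has_derivative
    (\<lambda>h. \<Sum>i\<in>Basis. (w x \<bullet> i) *\<^sub>R ?D i h + (w' h \<bullet> i) *\<^sub>R F x i)) (at x)"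
    by (intro has_derivative_sum has_derivative_scaleR wi F)
  have b: "((\<lambda>y. \<Sum>i\<in>Basis. (w x \<bullet> i) *\<^sub>R F y i) has_derivative
    (\<lambda>h. \<Sum>i\<in>Basis. (w x \<bullet> i) *\<^sub>R ?D i h)) (at x)"
    by (intro has_derivative_sum has_derivative_scaleR_right F)
  have "((\<lambda>y. F y (w x)) has_derivative (\<lambda>h. \<Sum>i\<in>Basis. (w x \<bullet> i) *\<^sub>R ?D i h)) (at x)"
    by (rule has_derivative_transform_within_open[OF b assms(1,2)])
      (use assms(4) linear_basis_expansion in metis)
  note c = frechet_derivative_eqI[OF this]
  have "((\<lambda>x. F x (w x)) has_derivative
    (\<lambda>h. \<Sum>i\<in>Basis. (w x \<bullet> i) *\<^sub>R ?D i h + (w' h \<bullet> i) *\<^sub>R F x i)) (at x)"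
    by (rule has_derivative_transform_within_open[OF a assms(1,2)])
      (use assms(4) linear_basis_expansion in metis)
  moreover have "F x (w' h) = (\<Sum>i\<in>Basis. (w' h \<bullet> i) *\<^sub>R F x i)" for h
    using assms(2,4) linear_basis_expansion by metis
  ultimately show ?thesis
    by (simp add: c sum.distrib)
qed

text \<open>The map \<open>F (y, k) = (y, B y k)\<close> has the left inverse \<open>G\<close>, and
  its derivative is block triangular with invertible diagonal blocks. The inverse function theorem
  makes \<open>G\<close> differentiable, and \<open>b y\<close> is the second component of
  \<open>G (y, w y)\<close>. Not even continuity of \<open>b\<close> is assumed in advance.\<close>

lemma differentiable_linear_solution:
  fixes B :: "'a::euclidean_space \<Rightarrow> 'b::euclidean_space \<Rightarrow> 'b"
  assumes S: "open S" "x \<in> S" and dB: "\<And>y v. y \<in> S \<Longrightarrow> (\<lambda>x. B x v) differentiable (at y)"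
    and lin: "\<And>y. y \<in> S \<Longrightarrow> linear (B y)" and inj: "\<And>y. y \<in> S \<Longrightarrow> inj (B y)"
    and b: "\<And>y. y \<in> S \<Longrightarrow> B y (b y) = w y" and w: "w differentiable (at x)"
  shows "b differentiable (at x)"
proof -
  define F where "F = (\<lambda>(y, k). (y, B y k))"
  define G where "G = (\<lambda>(y, k). (y, inv (B y) k))"
  have dB': "((\<lambda>p. B (fst p) v) differentiable (at y))" if "y \<in> S \<times> UNIV" for y :: "'a \<times> 'b" and v
    using that dB differentiable_compose[of "\<lambda>x. B x v" fst y UNIV]
    by (auto simp: bounded_linear_fst bounded_linear_imp_differentiable)
  have sub: "open (S \<times> (UNIV::'b set))" using S by (simp add: open_Times)
  have D: "((\<lambda>p. B (fst p) (snd p)) has_derivative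
      (\<lambda>h. frechet_derivative (\<lambda>p. B (fst p) (snd y)) (at y) h + B (fst y) (snd h))) (at y)"
    if "y \<in> S \<times> UNIV" for y
    by (rule has_derivative_linear_family[OF sub that dB'[OF that]])
      (auto intro: lin derivative_eq_intros)
  have DF: "(F has_derivative
      (\<lambda>h. (fst h, frechet_derivative (\<lambda>p. B (fst p) (snd y)) (at y) h + B (fst y) (snd h)))) (at y)"
    if "y \<in> S \<times> UNIV" for y
    unfolding F_def case_prod_unfold
    by (intro has_derivative_Pair D that) (auto intro: derivative_eq_intros)
  have dfst: "frechet_derivative (\<lambda>p. B (fst p) v) (at (x, k)) h
      = frechet_derivative (\<lambda>y. B y v) (at x) (fst h)" for v h k
  proof -
    have "((\<lambda>p. B (fst p) v) has_derivative (\<lambda>h. frechet_derivative (\<lambda>y. B y v) (at x) (fst h))) (at (x,k))"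
      by (rule has_derivative_compose[of fst fst "(x, k)" UNIV "\<lambda>y. B y v"])
        (simp_all add: has_derivative_fst has_derivative_ident frechet_derivativeD[OF dB[OF S(2)]])
    then show ?thesis using frechet_derivative_eqI by metis
  qed
  have invB: "B x (inv (B x) k) = k" for k
    using linear_injective_imp_surjective[OF lin[OF S(2)] inj[OF S(2)]] by (simp add: surj_f_inv_f)
  \<comment> \<open>Solution of the triangular system: subtract the contribution of the base
    direction, then apply the inverse of \<open>B x\<close>.\<close>
  define G' where "G' = (\<lambda>h. (fst h, inv (B x) (snd h - frechet_derivative (\<lambda>y. B y (b x)) (at x) (fst h))))"
  have "(G has_derivative G') (at (F (x, b x)))"
  proof (rule has_derivative_inverse_strong[OF sub _ _ _ DF])
    show "(x, b x) \<in> S \<times> UNIV" using S by auto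
    show "continuous_on (S \<times> UNIV) F"
      using DF by (meson continuous_at_imp_continuous_on has_derivative_continuous)
    show "G (F y) = y" if "y \<in> S \<times> UNIV" for y
      using that inj by (auto simp: F_def G_def)
  qed (use S in \<open>auto simp: dfst G'_def invB fun_eq_iff\<close>)
  then have 1: "G differentiable (at (x, w x))"
    using b[OF S(2)] by (auto simp: F_def differentiable_def)
  have "(\<lambda>y. snd (G (y, w y))) differentiable (at x)"
  proof (rule differentiable_compose[of snd "\<lambda>y. G (y, w y)"])
    show "(\<lambda>y. G (y, w y)) differentiable (at x)"
      by (rule differentiable_compose[of G "\<lambda>y. (y, w y)", OF 1]) (use w in simp)
  qed (simp add: bounded_linear_snd bounded_linear_imp_differentiable)
  moreover have "snd (G (y, w y)) = b y" if "y \<in> S" for y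
    by (simp add: G_def b[OF that, symmetric] inj[OF that])
  ultimately show ?thesis
    using differentiable_cong_open[OF S, of "\<lambda>y. snd (G (y, w y))" b] by simp
qed

section \<open>Symmetry of second derivatives and the bracket identity in a chart\<close>

lemma second_difference_mvt:
  fixes f :: "'a::real_normed_vector \<Rightarrow> real"
  assumes t: "t > 0" "t * (norm v + norm w) < e"
    and d1: "\<And>y. y \<in> ball x e \<Longrightarrow> f differentiable (at y)"
    and d2: "\<And>y. y \<in> ball x e \<Longrightarrow> (\<lambda>y. frechet_derivative f (at y) v) differentiable (at y)"
  shows "\<exists>p. norm (p - x) \<le> t * (norm v + norm w) \<and>
    f (x + t *\<^sub>R v + t *\<^sub>R w) - f (x + t *\<^sub>R v) - f (x + t *\<^sub>R w) + f x
      = t * t * frechet_derivative (\<lambda>y. frechet_derivative f (at y) v) (at p) w"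
proof -
  have nrm: "norm (s *\<^sub>R v + s' *\<^sub>R w) \<le> t * (norm v + norm w)"
    if "0 \<le> s" "s \<le> t" "0 \<le> s'" "s' \<le> t" for s s'
  proof -
    have "norm (s *\<^sub>R v + s' *\<^sub>R w) \<le> s * norm v + s' * norm w"
      using norm_triangle_ineq[of "s *\<^sub>R v" "s' *\<^sub>R w"] that by simp
    also have "\<dots> \<le> t * norm v + t * norm w"
      using that by (intro add_mono mult_right_mono) auto
    finally show ?thesis by (simp add: algebra_simps)
  qed
  have inb: "x + s *\<^sub>R v + s' *\<^sub>R w \<in> ball x e"
    if "0 \<le> s" "s \<le> t" "0 \<le> s'" "s' \<le> t" for s s'
    using nrm[OF that] t(2) by (simp add: dist_norm norm_minus_commute algebra_simps)
  \<comment> \<open>The mean value theorem is used twice: \<open>\<phi>\<close> is the difference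
    across \<open>t *\<^sub>R w\<close> as a function of the step along \<open>v\<close>;
    \<open>\<psi>\<close> below then varies the resulting derivative along \<open>w\<close>.\<close>
  define \<phi> where "\<phi> = (\<lambda>s. f (x + s *\<^sub>R v + t *\<^sub>R w) - f (x + s *\<^sub>R v))"
  let ?Df = "\<lambda>y. frechet_derivative f (at y)"
  have L: "((\<lambda>s. f (y + s *\<^sub>R u)) has_real_derivative ?Df (y + s *\<^sub>R u) u) (at s)"
    if "y + s *\<^sub>R u \<in> ball x e" for y s u
  proof -
    have "((\<lambda>s. f (y + s *\<^sub>R u)) has_derivative (\<lambda>h. ?Df (y + s *\<^sub>R u) (h *\<^sub>R u))) (at s)"
      by (rule has_derivative_compose[where f="\<lambda>s. y + s *\<^sub>R u"])
        (auto intro!: derivative_eq_intros frechet_derivativeD d1 that)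
    then show ?thesis
      using linear_cmul[OF linear_frechet_derivative[OF d1[OF that]]]
      by (simp add: has_field_derivative_def mult_commute_abs)
  qed
  have "\<exists>s>0. s < t \<and> \<phi> t - \<phi> 0 = (t - 0) * (?Df (x + s *\<^sub>R v + t *\<^sub>R w) v - ?Df (x + s *\<^sub>R v) v)"
    unfolding \<phi>_def
  proof (rule MVT2[OF t(1)])
    fix s assume s: "0 \<le> s" "s \<le> t"
    have "(x + t *\<^sub>R w) + s *\<^sub>R v \<in> ball x e" "x + s *\<^sub>R v \<in> ball x e"
      using inb[OF s, of t] inb[OF s, of 0] t by (auto simp: algebra_simps)
    then show "((\<lambda>s. f (x + s *\<^sub>R v + t *\<^sub>R w) - f (x + s *\<^sub>R v)) has_real_derivative
      ?Df (x + s *\<^sub>R v + t *\<^sub>R w) v - ?Df (x + s *\<^sub>R v) v) (at s)"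
      using DERIV_diff[OF L[of "x + t *\<^sub>R w" s v] L[of x s v]] by (simp add: algebra_simps)
  qed
  then obtain s where s: "0 < s" "s < t"
    "\<phi> t - \<phi> 0 = t * (?Df (x + s *\<^sub>R v + t *\<^sub>R w) v - ?Df (x + s *\<^sub>R v) v)"
    by auto
  define \<psi> where "\<psi> = (\<lambda>r. ?Df (x + s *\<^sub>R v + r *\<^sub>R w) v)"
  have "\<exists>r>0. r < t \<and> \<psi> t - \<psi> 0 =
      (t - 0) * frechet_derivative (\<lambda>y. ?Df y v) (at (x + s *\<^sub>R v + r *\<^sub>R w)) w"
    unfolding \<psi>_def
  proof (rule MVT2[OF t(1)])
    fix r assume r: "0 \<le> r" "r \<le> t"
    let ?p = "x + s *\<^sub>R v + r *\<^sub>R w"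
    have p: "?p \<in> ball x e" using inb r s by auto
    have "((\<lambda>r. ?Df (x + s *\<^sub>R v + r *\<^sub>R w) v) has_derivative
        (\<lambda>h. frechet_derivative (\<lambda>y. ?Df y v) (at ?p) (h *\<^sub>R w))) (at r)"
      by (rule has_derivative_compose[where f="\<lambda>r. x + s *\<^sub>R v + r *\<^sub>R w" and g="\<lambda>y. ?Df y v"])
        (auto intro!: derivative_eq_intros frechet_derivativeD d2 p)
    then show "((\<lambda>r. ?Df (x + s *\<^sub>R v + r *\<^sub>R w) v) has_real_derivative
        frechet_derivative (\<lambda>y. ?Df y v) (at ?p) w) (at r)"
      using linear_cmul[OF linear_frechet_derivative[OF d2[OF p]]]
      by (simp add: has_field_derivative_def mult_commute_abs)
  qed
  then obtain r where r: "0 < r" "r < t"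
    "\<psi> t - \<psi> 0 = t * frechet_derivative (\<lambda>y. ?Df y v) (at (x + s *\<^sub>R v + r *\<^sub>R w)) w"
    by auto
  have "f (x + t *\<^sub>R v + t *\<^sub>R w) - f (x + t *\<^sub>R v) - f (x + t *\<^sub>R w) + f x = \<phi> t - \<phi> 0"
    by (simp add: \<phi>_def)
  also have "\<dots> = t * (\<psi> t - \<psi> 0)"
    using s(3) by (simp add: \<psi>_def)
  finally show ?thesis
    using r s nrm[of s r] by (intro exI[of _ "x + s *\<^sub>R v + r *\<^sub>R w"]) (simp add: algebra_simps)
qed

text \<open>The second difference is symmetric in \<open>v\<close> and \<open>w\<close>, so the two
  mixed derivatives take equal values at points \<open>p n\<close> and \<open>q n\<close> that tend
  to \<open>x\<close>. Their continuity transfers the equality to \<open>x\<close>.\<close>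

lemma second_derivative_symmetric:
  fixes f :: "'a::real_normed_vector \<Rightarrow> real"
  assumes "open S" "x \<in> S" "Ck_on 2 S f"
  shows "frechet_derivative (\<lambda>y. frechet_derivative f (at y) v) (at x) w
       = frechet_derivative (\<lambda>y. frechet_derivative f (at y) w) (at x) v"
proof -
  let ?H = "\<lambda>v w p. frechet_derivative (\<lambda>y. frechet_derivative f (at y) v) (at p) w"
  obtain e where e: "e > 0" "ball x e \<subseteq> S"
    using assms open_contains_ball by metis
  have C: "Ck_on (Suc (Suc 0)) S f" using assms(3) by (simp add: numeral_2_eq_2)
  have d: "f differentiable (at y)" "(\<lambda>y. frechet_derivative f (at y) v) differentiable (at y)"
    if "y \<in> ball x e" for y v
    using C e that by auto
  have cont: "isCont (?H v w) x" for v w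
    using C assms(2) continuous_on_eq_continuous_at[OF assms(1), of "?H v w"] by auto
  \<comment> \<open>The summand 1 keeps \<open>c\<close> positive when \<open>v\<close> and
    \<open>w\<close> both vanish; the factor 2 in \<open>t\<close> keeps every step strictly inside
    the ball.\<close>
  define c where "c = norm v + norm w + 1"
  define t where "t = (\<lambda>n. e / (2 * c) * inverse (real (Suc n)))"
  have c: "c > 0" by (simp add: c_def add_nonneg_pos)
  have t: "t n > 0" "t n * (norm v + norm w) < e" for n
  proof -
    show "t n > 0" using e c by (simp add: t_def)
    have "t n * (norm v + norm w) \<le> t n * c"
      using \<open>t n > 0\<close> by (intro mult_left_mono) (auto simp: c_def)
    also have "\<dots> = e / 2 * inverse (real (Suc n))" using c by (simp add: t_def)
    also have "\<dots> \<le> e / 2 * 1"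
      using e by (intro mult_left_mono) (auto simp: inverse_le_1_iff)
    also have "\<dots> < e" using e by simp
    finally show "t n * (norm v + norm w) < e" .
  qed
  have "t \<longlonglongrightarrow> 0"
    unfolding t_def by (rule tendsto_mult_right_zero[OF LIMSEQ_inverse_real_of_nat])
  then have t0: "(\<lambda>n. t n * (norm v + norm w)) \<longlonglongrightarrow> 0"
    by (simp add: tendsto_mult_left_zero)
  obtain p where p: "norm (p n - x) \<le> t n * (norm v + norm w)"
    "f (x + t n *\<^sub>R v + t n *\<^sub>R w) - f (x + t n *\<^sub>R v) - f (x + t n *\<^sub>R w) + f x = t n * t n * ?H v w (p n)" for n
    using second_difference_mvt[OF t d] by metis
  have t': "t n * (norm w + norm v) < e" for n using t(2)[of n] by (simp add: add.commute)
  obtain q where q: "norm (q n - x) \<le> t n * (norm w + norm v)"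
    "f (x + t n *\<^sub>R w + t n *\<^sub>R v) - f (x + t n *\<^sub>R w) - f (x + t n *\<^sub>R v) + f x = t n * t n * ?H w v (q n)" for n
    using second_difference_mvt[OF t(1) t' d] by metis
  have "?H v w (p n) = ?H w v (q n)" for n
  proof -
    have "t n * t n * ?H v w (p n) = t n * t n * ?H w v (q n)"
      unfolding p(2)[symmetric] q(2)[symmetric] by (simp add: algebra_simps)
    then show ?thesis using t(1)[of n] by simp
  qed
  then have H: "(\<lambda>n. ?H v w (p n)) = (\<lambda>n. ?H w v (q n))" by simp
  have "p \<longlonglongrightarrow> x"
    by (rule LIM_zero_cancel, rule Lim_null_comparison[OF _ t0]) (use p(1) in auto)
  from isCont_tendsto_compose[OF cont this] have 1: "(\<lambda>n. ?H v w (p n)) \<longlonglongrightarrow> ?H v w x" .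
  have "q \<longlonglongrightarrow> x"
    by (rule LIM_zero_cancel, rule Lim_null_comparison[OF _ t0]) (use q(1) in \<open>auto simp: add.commute\<close>)
  from isCont_tendsto_compose[OF cont this] have 2: "(\<lambda>n. ?H w v (q n)) \<longlonglongrightarrow> ?H w v x" .
  show ?thesis
    using 1 2 unfolding H by (rule LIMSEQ_unique)
qed

text \<open>Each term on the left splits into a second derivative of \<open>f\<close> and a term
  with the derivative of one field; the second derivatives cancel by symmetry. The fields are
  differentiable at the single point \<open>x\<close> only, which is how much is established for
  horizontal lifts.\<close>

lemma bracket_second_derivative:
  fixes f :: "'a::euclidean_space \<Rightarrow> real"
  assumes S: "open S" "x \<in> S" and f: "Ck_on 2 S f"
    and V: "V differentiable (at x)" and W: "W differentiable (at x)"
  shows "frechet_derivative (\<lambda>y. frechet_derivative f (at y) (W y)) (at x) (V x)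
       - frechet_derivative (\<lambda>y. frechet_derivative f (at y) (V y)) (at x) (W x)
       = frechet_derivative f (at x) (frechet_derivative W (at x) (V x) - frechet_derivative V (at x) (W x))"
proof -
  have C: "Ck_on (Suc (Suc 0)) S f" using f by (simp add: numeral_2_eq_2)
  have lin: "linear (frechet_derivative f (at y))" if "y \<in> S" for y
    using C that by (intro linear_frechet_derivative) auto
  have D: "frechet_derivative (\<lambda>y. frechet_derivative f (at y) (U y)) (at x) h
    = frechet_derivative (\<lambda>y. frechet_derivative f (at y) (U x)) (at x) h
      + frechet_derivative f (at x) (frechet_derivative U (at x) h)"
    if "U differentiable (at x)" for U h
    using C S by (subst frechet_derivative_eqI[OF has_derivative_linear_family[OF S _ lin frechet_derivativeD[OF that]]]) auto
  show ?thesis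
    by (simp add: D[OF V] D[OF W] second_derivative_symmetric[OF S f, of "W x" "V x"]
        linear_diff[OF lin[OF S(2)]])
qed

subsection \<open>Charts and the slit bundle\<close>

text \<open>Formulated without a topology, so that the same locale covers both the base and
  \<open>slit N\<close>, which comes with an atlas only.\<close>

locale smooth_atlas =
  fixes N :: "('a, 'e::euclidean_space) charted_space"
  assumes chart_subset: "c \<in> charts N \<Longrightarrow> fst c \<subseteq> points N"
    and chart_inj: "c \<in> charts N \<Longrightarrow> inj_on (snd c) (fst c)"
    and chart_open: "c \<in> charts N \<Longrightarrow> open (chart_image c)"
    and chart_at_charts: "p \<in> points N \<Longrightarrow> chart_at N p \<in> charts N"
    and chart_at_mem: "p \<in> points N \<Longrightarrow> p \<in> fst (chart_at N p)"
    and transition_smooth: "c \<in> charts N \<Longrightarrow> d \<in> charts N \<Longrightarrow>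
      smooth_on (snd c ` (fst c \<inter> fst d)) (snd d \<circ> chart_inv c)"

text \<open>On the domain of \<open>c\<close> this is the inverse of \<open>coords N c p\<close>:
  components in \<open>c\<close> are carried back to the preferred chart at
  \<open>p\<close>.\<close>

definition uncoords ::
  "('a, 'e::real_normed_vector) charted_space \<Rightarrow> ('a, 'e) chart \<Rightarrow> 'a \<Rightarrow> 'e \<Rightarrow> 'e" where
  "uncoords N c p = frechet_derivative (snd (chart_at N p) \<circ> chart_inv c) (at (snd c p))"

text \<open>The coordinate field with constant components \<open>z\<close> in \<open>c\<close>,
  damped by \<open>\<psi>\<close> and extended by zero. Such global fields are the arguments that an
  abstract connection accepts.\<close>

definition const_field ::
  "('a, 'e::real_normed_vector) charted_space \<Rightarrow> ('a, 'e) chart \<Rightarrow> ('a \<Rightarrow> real) \<Rightarrow> 'e \<Rightarrow> 'a \<Rightarrow> 'e" where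
  "const_field N c \<psi> z p = (if p \<in> fst c then \<psi> p *\<^sub>R uncoords N c p z else 0)"

text \<open>In the absence of a topology, closedness of the supporting set \<open>K\<close> is
  expressed by openness of its complement in every chart. Compactness is left out of the notion
  because it would be lost on passing to the slit bundle.\<close>

definition cutoff ::
  "('a, 'e::real_normed_vector) charted_space \<Rightarrow> ('a, 'e) chart \<Rightarrow> ('a \<Rightarrow> real) \<Rightarrow> bool" where
  "cutoff N c \<psi> \<longleftrightarrow> smooth_fun N \<psi> \<and>
     (\<exists>K\<subseteq>fst c. (\<forall>d\<in>charts N. open (snd d ` (fst d - K))) \<and> (\<forall>p\<in>points N - K. \<psi> p = 0))"

lemma chart_image_mem: "p \<in> fst c \<Longrightarrow> snd c p \<in> chart_image c"
  by (simp add: chart_image_def)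

lemma chart_inv_right: "x \<in> chart_image c \<Longrightarrow> snd c (chart_inv c x) = x"
  by (simp add: chart_image_def chart_inv_def f_inv_into_f)

lemma chart_inv_mem: "x \<in> chart_image c \<Longrightarrow> chart_inv c x \<in> fst c"
  by (simp add: chart_image_def chart_inv_def inv_into_into)

lemma smooth_funD: "smooth_fun N f \<Longrightarrow> c \<in> charts N \<Longrightarrow> smooth_on (chart_image c) (f \<circ> chart_inv c)"
  by (simp add: smooth_fun_def)

context smooth_atlas
begin

lemma chart_inv_left: "c \<in> charts N \<Longrightarrow> p \<in> fst c \<Longrightarrow> chart_inv c (snd c p) = p"
  by (simp add: chart_inj chart_inv_def)

lemma overlap_open: "c \<in> charts N \<Longrightarrow> d \<in> charts N \<Longrightarrow> open (snd c ` (fst c \<inter> fst d))"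
  by (rule smooth_on_open[OF transition_smooth])

lemma overlap_iff:
  assumes "c \<in> charts N"
  shows "x \<in> snd c ` (fst c \<inter> A) \<longleftrightarrow> x \<in> chart_image c \<and> chart_inv c x \<in> A"
proof
  assume "x \<in> snd c ` (fst c \<inter> A)"
  then obtain p where "p \<in> fst c" "p \<in> A" "x = snd c p" by auto
  then show "x \<in> chart_image c \<and> chart_inv c x \<in> A"
    using chart_inv_left[OF assms] chart_image_mem by metis
next
  assume "x \<in> chart_image c \<and> chart_inv c x \<in> A"
  then show "x \<in> snd c ` (fst c \<inter> A)"
    by (intro image_eqI[of _ _ "chart_inv c x"]) (auto simp: chart_inv_right chart_inv_mem)
qed

lemma has_derivative_change_chart:
  assumes "c \<in> charts N" "d \<in> charts N" "p \<in> fst c" "p \<in> fst d"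
    and "(f \<circ> chart_inv d) differentiable (at (snd d p))"
  shows "((f \<circ> chart_inv c) has_derivative
    (\<lambda>v. frechet_derivative (f \<circ> chart_inv d) (at (snd d p))
       (frechet_derivative (snd d \<circ> chart_inv c) (at (snd c p)) v))) (at (snd c p))"
proof -
  have p: "snd c p \<in> snd c ` (fst c \<inter> fst d)" using assms by auto
  have eq: "(snd d \<circ> chart_inv c) (snd c p) = snd d p"
    using assms chart_inv_left by simp
  have f: "((f \<circ> chart_inv d) has_derivative frechet_derivative (f \<circ> chart_inv d) (at (snd d p)))
      (at ((snd d \<circ> chart_inv c) (snd c p)))"
    unfolding eq by (rule frechet_derivativeD[OF assms(5)])
  from has_derivative_compose[OF frechet_derivativeD[OF
        smooth_on_differentiable[OF transition_smooth[OF assms(1,2)] p]] f]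
  show ?thesis
  proof (rule has_derivative_transform_within_open[OF _ overlap_open[OF assms(1,2)] p])
    fix x assume "x \<in> snd c ` (fst c \<inter> fst d)"
    then show "(f \<circ> chart_inv d) ((snd d \<circ> chart_inv c) x) = (f \<circ> chart_inv c) x"
      using chart_inv_left[OF assms(2)] overlap_iff[OF assms(1)] by auto
  qed
qed

lemma dir_deriv_chart:
  assumes "d \<in> charts N" "p \<in> fst d" "(f \<circ> chart_inv d) differentiable (at (snd d p))"
  shows "dir_deriv N f p v = frechet_derivative (f \<circ> chart_inv d) (at (snd d p)) (coords N d p v)"
proof -
  have p: "p \<in> points N" using assms chart_subset by blast
  show ?thesis
    using frechet_derivative_eqI[OF has_derivative_change_chart[OF
          chart_at_charts[OF p] assms(1) chart_at_mem[OF p] assms(2,3)]]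
    by (simp add: dir_deriv_def coords_def)
qed

lemma transition_differentiable:
  assumes "c \<in> charts N" "d \<in> charts N" "p \<in> fst c" "p \<in> fst d"
  shows "(snd d \<circ> chart_inv c) differentiable (at (snd c p))"
  by (rule smooth_on_differentiable[OF transition_smooth[OF assms(1,2)]]) (use assms in auto)

lemma linear_transition:
  assumes "c \<in> charts N" "d \<in> charts N" "p \<in> fst c" "p \<in> fst d"
  shows "linear (frechet_derivative (snd d \<circ> chart_inv c) (at (snd c p)))"
  by (rule linear_frechet_derivative[OF transition_differentiable[OF assms]])

lemma frechet_derivative_id_chart:
  assumes "c \<in> charts N" "p \<in> fst c"
  shows "frechet_derivative (snd c \<circ> chart_inv c) (at (snd c p)) = (\<lambda>v. v)"
proof -
  have "frechet_derivative (snd c \<circ> chart_inv c) (at (snd c p)) = frechet_derivative (\<lambda>x. x) (at (snd c p))"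
    by (rule frechet_derivative_cong_open[OF chart_open[OF assms(1)] chart_image_mem[OF assms(2)]])
      (simp add: chart_inv_right)
  then show ?thesis by simp
qed

lemma transition_cancel:
  assumes "c \<in> charts N" "d \<in> charts N" "p \<in> fst c" "p \<in> fst d"
  shows "frechet_derivative (snd c \<circ> chart_inv d) (at (snd d p))
     (frechet_derivative (snd d \<circ> chart_inv c) (at (snd c p)) v) = v"
  using frechet_derivative_eqI[OF has_derivative_change_chart[OF assms
        transition_differentiable[OF assms(2,1,4,3)]]] frechet_derivative_id_chart[OF assms(1,3)]
  by metis

lemma coords_eq:
  "coords N d p v = frechet_derivative (snd d \<circ> chart_inv (chart_at N p)) (at (snd (chart_at N p) p)) v"
  by (simp add: coords_def dir_deriv_def)

lemma coords_self: "p \<in> points N \<Longrightarrow> coords N (chart_at N p) p v = v"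
  unfolding coords_eq using frechet_derivative_id_chart[OF chart_at_charts chart_at_mem] by metis

lemma coords_change:
  assumes "c \<in> charts N" "d \<in> charts N" "p \<in> fst c" "p \<in> fst d"
  shows "coords N d p v = frechet_derivative (snd d \<circ> chart_inv c) (at (snd c p)) (coords N c p v)"
  unfolding coords_def[of N d]
  by (rule dir_deriv_chart[OF assms(1,3) transition_differentiable[OF assms]])

lemma linear_coords:
  assumes "d \<in> charts N" "p \<in> fst d"
  shows "linear (coords N d p)"
proof -
  have p: "p \<in> points N" using assms chart_subset by blast
  show ?thesis
    using linear_transition[OF chart_at_charts[OF p] assms(1) chart_at_mem[OF p] assms(2)]
    by (simp add: coords_eq[abs_def])
qed

lemma linear_uncoords:
  assumes "d \<in> charts N" "p \<in> fst d"
  shows "linear (uncoords N d p)"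
proof -
  have p: "p \<in> points N" using assms chart_subset by blast
  show ?thesis
    using linear_transition[OF assms(1) chart_at_charts[OF p] assms(2) chart_at_mem[OF p]]
    by (simp add: uncoords_def)
qed

lemma coords_uncoords:
  assumes "d \<in> charts N" "p \<in> fst d"
  shows "coords N d p (uncoords N d p z) = z"
proof -
  have p: "p \<in> points N" using assms chart_subset by blast
  show ?thesis
    using transition_cancel[OF assms(1) chart_at_charts[OF p] assms(2) chart_at_mem[OF p]]
    by (simp add: uncoords_def coords_eq)
qed

lemma uncoords_coords:
  assumes "d \<in> charts N" "p \<in> fst d"
  shows "uncoords N d p (coords N d p z) = z"
proof -
  have p: "p \<in> points N" using assms chart_subset by blast
  show ?thesis
    using transition_cancel[OF chart_at_charts[OF p] assms(1) chart_at_mem[OF p] assms(2)]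
    by (simp add: uncoords_def coords_eq)
qed

lemma coords_eq_0_iff: "d \<in> charts N \<Longrightarrow> p \<in> fst d \<Longrightarrow> coords N d p v = 0 \<longleftrightarrow> v = 0"
  by (metis uncoords_coords linear_0 linear_coords)

lemma uncoords_eq_0_iff: "d \<in> charts N \<Longrightarrow> p \<in> fst d \<Longrightarrow> uncoords N d p v = 0 \<longleftrightarrow> v = 0"
  by (metis coords_uncoords linear_0 linear_uncoords)

lemma coords_uncoords_change:
  assumes "c \<in> charts N" "d \<in> charts N" "p \<in> fst c" "p \<in> fst d"
  shows "coords N d p (uncoords N c p z) = frechet_derivative (snd d \<circ> chart_inv c) (at (snd c p)) z"
  by (simp add: coords_change[OF assms] coords_uncoords assms)

lemma smooth_fun_differentiable:
  "smooth_fun N f \<Longrightarrow> c \<in> charts N \<Longrightarrow> p \<in> fst c \<Longrightarrow> (f \<circ> chart_inv c) differentiable (at (snd c p))"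
  by (rule smooth_on_differentiable[OF smooth_funD chart_image_mem])

lemma chart_inv_points: "c \<in> charts N \<Longrightarrow> x \<in> chart_image c \<Longrightarrow> chart_inv c x \<in> points N"
  using chart_subset[of c] chart_inv_mem[of x c] by blast

lemma dir_deriv_cong:
  assumes "p \<in> points N" "\<And>q. q \<in> points N \<Longrightarrow> f q = g q"
  shows "dir_deriv N f p = dir_deriv N g p"
  unfolding dir_deriv_def
  by (rule frechet_derivative_cong_open[OF chart_open[OF chart_at_charts[OF assms(1)]]
        chart_image_mem[OF chart_at_mem[OF assms(1)]]])
    (use assms chart_inv_points[OF chart_at_charts] in auto)

lemma smooth_fun_cong:
  assumes "smooth_fun N f" "\<And>q. q \<in> points N \<Longrightarrow> f q = g q"
  shows "smooth_fun N g"
  unfolding smooth_fun_def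
  by (intro ballI smooth_on_cong[OF smooth_funD[OF assms(1)]]) (use assms(2) chart_inv_points in auto)

text \<open>Every chart \<open>d\<close> is the union of two open pieces: the overlap with
  \<open>c\<close>, where the field is \<open>\<psi>\<close> times a derivative of the transition
  map, and the complement of \<open>K\<close>, where it is zero.\<close>

lemma const_field_smooth:
  assumes c: "c \<in> charts N" and \<psi>: "cutoff N c \<psi>"
  shows "smooth_vector_field N (const_field N c \<psi> z)"
  unfolding smooth_vector_field_def
proof
  fix d assume d: "d \<in> charts N"
  obtain K where K: "K \<subseteq> fst c" "\<And>d. d \<in> charts N \<Longrightarrow> open (snd d ` (fst d - K))"
    "\<And>p. p \<in> points N - K \<Longrightarrow> \<psi> p = 0" and s: "smooth_fun N \<psi>"
    using \<psi> by (auto simp: cutoff_def)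
  let ?A = "snd d ` (fst d \<inter> fst c)" and ?B = "snd d ` (fst d - K)"
  have img: "chart_image d = ?A \<union> ?B" using K by (auto simp: chart_image_def)
  have comp: "smooth_on ?A (\<lambda>x. frechet_derivative (snd d \<circ> chart_inv c) (at ((snd c \<circ> chart_inv d) x)) z)"
    by (rule smooth_on_compose[OF transition_smooth[OF d c] smooth_on_derivative[OF transition_smooth[OF c d]]])
      (use chart_inv_left[OF d] in auto)
  have 1: "smooth_on ?A (field_in_chart N (const_field N c \<psi> z) d)"
  proof (rule smooth_on_cong[OF smooth_on_scaleR[OF
          smooth_on_subset[OF smooth_funD[OF s d] overlap_open[OF d c]] comp]])
    show "?A \<subseteq> chart_image d" by (auto simp: chart_image_def)
    fix x assume x: "x \<in> ?A"
    then have m: "chart_inv d x \<in> fst d" "chart_inv d x \<in> fst c"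
      using overlap_iff[OF d] chart_inv_mem[of x d] by blast+
    show "(\<psi> \<circ> chart_inv d) x *\<^sub>R frechet_derivative (snd d \<circ> chart_inv c) (at ((snd c \<circ> chart_inv d) x)) z
        = field_in_chart N (const_field N c \<psi> z) d x"
      using m by (simp add: field_in_chart_def const_field_def linear_cmul[OF linear_coords[OF d m(1)]]
          coords_uncoords_change[OF c d m(2,1)])
  qed
  have 2: "smooth_on ?B (field_in_chart N (const_field N c \<psi> z) d)"
  proof (rule smooth_on_cong[OF smooth_on_const[OF K(2)[OF d], of 0]])
    fix x assume "x \<in> ?B"
    then obtain p where p: "p \<in> fst d" "p \<notin> K" "x = snd d p" by auto
    then have "\<psi> p = 0" using K(3) chart_subset[OF d] by auto
    then have "const_field N c \<psi> z p = 0" by (simp add: const_field_def)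
    then show "0 = field_in_chart N (const_field N c \<psi> z) d x"
      using p by (simp add: field_in_chart_def chart_inv_left[OF d] linear_0[OF linear_coords[OF d]])
  qed
  show "smooth_on (chart_image d) (field_in_chart N (const_field N c \<psi> z) d)"
    unfolding img using 1 2 by (rule smooth_on_Un)
qed

end

section \<open>The atlas of the slit bundle and its vertical directions\<close>

lemma fst_slit_chart: "fst (slit_chart M c) = fst c \<times> (- {0})"
  by (auto simp: slit_chart_def)

lemma snd_slit_chart: "snd (slit_chart M c) (p, v) = (snd c p, coords M c p v)"
  by (simp add: slit_chart_def)

lemma points_slit: "points (slit M) = points M \<times> (- {0})"
  by (auto simp: slit_def)

lemma charts_slit: "charts (slit M) = slit_chart M ` charts M"
  by (simp add: slit_def)

lemma chart_at_slit: "chart_at (slit M) u = slit_chart M (chart_at M (fst u))"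
  by (simp add: slit_def)

context smooth_atlas
begin

lemma slit_chart_image:
  assumes "c \<in> charts N"
  shows "chart_image (slit_chart N c) = chart_image c \<times> (- {0})"
proof (intro equalityI subsetI)
  fix z assume "z \<in> chart_image (slit_chart N c)"
  then obtain p v where "p \<in> fst c" "v \<noteq> 0" "z = snd (slit_chart N c) (p, v)"
    by (auto simp: chart_image_def fst_slit_chart)
  then show "z \<in> chart_image c \<times> (- {0})"
    using coords_eq_0_iff[OF assms] by (simp add: chart_image_def snd_slit_chart)
next
  fix z :: "'e \<times> 'e" assume "z \<in> chart_image c \<times> (- {0})"
  then obtain x y where z: "z = (x, y)" and x: "x \<in> chart_image c" and y: "y \<noteq> 0" by auto
  let ?p = "chart_inv c x"
  have "(x, y) = snd (slit_chart N c) (?p, uncoords N c ?p y)"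
    using x chart_inv_mem[OF x] by (simp add: snd_slit_chart chart_inv_right coords_uncoords[OF assms])
  moreover have "(?p, uncoords N c ?p y) \<in> fst (slit_chart N c)"
    using chart_inv_mem[OF x] uncoords_eq_0_iff[OF assms] y by (simp add: fst_slit_chart)
  ultimately show "z \<in> chart_image (slit_chart N c)"
    unfolding chart_image_def z by (rule image_eqI)
qed

lemma slit_chart_inj:
  assumes "c \<in> charts N"
  shows "inj_on (snd (slit_chart N c)) (fst (slit_chart N c))"
proof (rule inj_onI)
  fix u w assume "u \<in> fst (slit_chart N c)" "w \<in> fst (slit_chart N c)"
    "snd (slit_chart N c) u = snd (slit_chart N c) w"
  then show "u = w"
    using chart_inv_left[OF assms] uncoords_coords[OF assms]
    by (cases u; cases w) (simp add: fst_slit_chart snd_slit_chart, metis)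
qed

lemma slit_chart_inv:
  assumes "c \<in> charts N" "x \<in> chart_image c" "y \<noteq> 0"
  shows "chart_inv (slit_chart N c) (x, y) = (chart_inv c x, uncoords N c (chart_inv c x) y)"
proof -
  let ?p = "chart_inv c x"
  have "snd (slit_chart N c) (?p, uncoords N c ?p y) = (x, y)"
    using assms by (simp add: snd_slit_chart chart_inv_right coords_uncoords[OF assms(1) chart_inv_mem])
  moreover have "(?p, uncoords N c ?p y) \<in> fst (slit_chart N c)"
    using chart_inv_mem[OF assms(2)] uncoords_eq_0_iff[OF assms(1)] assms(3) by (simp add: fst_slit_chart)
  ultimately show ?thesis
    unfolding chart_inv_def using inv_into_f_f[OF slit_chart_inj[OF assms(1)]] by metis
qed

lemma slit_chart_inv':
  assumes "c \<in> charts N" "z \<in> chart_image c \<times> (- {0})"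
  shows "chart_inv (slit_chart N c) z = (chart_inv c (fst z), uncoords N c (chart_inv c (fst z)) (snd z))"
  using slit_chart_inv[OF assms(1), of "fst z" "snd z"] assms(2) by (simp add: mem_Times_iff)

lemma slit_overlap:
  assumes "c \<in> charts N"
  shows "snd (slit_chart N c) ` (fst (slit_chart N c) \<inter> fst (slit_chart N d))
    = snd c ` (fst c \<inter> fst d) \<times> (- {0})"
proof (intro equalityI subsetI)
  fix z assume "z \<in> snd (slit_chart N c) ` (fst (slit_chart N c) \<inter> fst (slit_chart N d))"
  then obtain p v where "p \<in> fst c" "p \<in> fst d" "v \<noteq> 0" "z = snd (slit_chart N c) (p, v)"
    by (auto simp: fst_slit_chart)
  then show "z \<in> snd c ` (fst c \<inter> fst d) \<times> (- {0})"
    using coords_eq_0_iff[OF assms] by (simp add: snd_slit_chart)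
next
  fix z :: "'e \<times> 'e" assume "z \<in> snd c ` (fst c \<inter> fst d) \<times> (- {0})"
  then obtain p y where z: "z = (snd c p, y)" and p: "p \<in> fst c" "p \<in> fst d" and y: "y \<noteq> 0" by auto
  have "(snd c p, y) = snd (slit_chart N c) (p, uncoords N c p y)"
    using p by (simp add: snd_slit_chart coords_uncoords[OF assms])
  moreover have "(p, uncoords N c p y) \<in> fst (slit_chart N c) \<inter> fst (slit_chart N d)"
    using p uncoords_eq_0_iff[OF assms] y by (simp add: fst_slit_chart)
  ultimately show "z \<in> snd (slit_chart N c) ` (fst (slit_chart N c) \<inter> fst (slit_chart N d))"
    unfolding z by (rule image_eqI)
qed

lemma slit_transition:
  assumes "c \<in> charts N" "d \<in> charts N" "x \<in> snd c ` (fst c \<inter> fst d)" "y \<noteq> 0"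
  shows "(snd (slit_chart N d) \<circ> chart_inv (slit_chart N c)) (x, y)
    = ((snd d \<circ> chart_inv c) x, frechet_derivative (snd d \<circ> chart_inv c) (at x) y)"
proof -
  have x: "x \<in> chart_image c" "chart_inv c x \<in> fst d" "chart_inv c x \<in> fst c"
    using assms(3) overlap_iff[OF assms(1)] chart_inv_mem[of x c] by blast+
  show ?thesis
    using coords_uncoords_change[OF assms(1,2) x(3,2)]
    by (simp add: slit_chart_inv[OF assms(1) x(1) assms(4)] snd_slit_chart chart_inv_right[OF x(1)])
qed

lemma slit_transition_smooth:
  assumes "c \<in> charts N" "d \<in> charts N"
  shows "smooth_on (snd c ` (fst c \<inter> fst d) \<times> (- {0}))
     (snd (slit_chart N d) \<circ> chart_inv (slit_chart N c))"
proof -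
  let ?U = "snd c ` (fst c \<inter> fst d)" and ?t = "snd d \<circ> chart_inv c"
  have o: "open (?U \<times> (- {0::'e}))"
    using overlap_open[OF assms] by (intro open_Times) auto
  have f: "smooth_on (?U \<times> (- {0::'e})) (\<lambda>z. fst z)" "smooth_on (?U \<times> (- {0::'e})) (\<lambda>z. snd z)"
    using smooth_on_linear[OF o bounded_linear_fst] smooth_on_linear[OF o bounded_linear_snd] by auto
  have 1: "smooth_on (?U \<times> (- {0::'e})) (\<lambda>z. ?t (fst z))"
    by (rule smooth_on_compose[OF f(1) transition_smooth[OF assms]]) auto
  have 2: "smooth_on (?U \<times> (- {0::'e})) (\<lambda>z. frechet_derivative ?t (at (fst z)) (snd z))"
  proof (rule smooth_on_linear_family[OF _ _ f(2)])
    show "smooth_on (?U \<times> (- {0::'e})) (\<lambda>z. frechet_derivative ?t (at (fst z)) v)" for v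
      by (rule smooth_on_compose[OF f(1) smooth_on_derivative[OF transition_smooth[OF assms]]]) auto
    show "linear (frechet_derivative ?t (at (fst z)))" if "z \<in> ?U \<times> (- {0::'e})" for z
      using that linear_transition[OF assms] by auto
  qed
  show ?thesis
  proof (rule smooth_on_cong[OF smooth_on_Pair[OF 1 2]])
    fix z assume "z \<in> ?U \<times> (- {0::'e})"
    then show "(?t (fst z), frechet_derivative ?t (at (fst z)) (snd z))
        = (snd (slit_chart N d) \<circ> chart_inv (slit_chart N c)) z"
      using slit_transition[OF assms, of "fst z" "snd z"] by (simp add: mem_Times_iff)
  qed
qed

lemma smooth_atlas_slit: "smooth_atlas (slit N)"
proof
  fix u assume u: "u \<in> points (slit N)"
  show "chart_at (slit N) u \<in> charts (slit N)" "u \<in> fst (chart_at (slit N) u)"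
    using u chart_at_charts chart_at_mem
    by (auto simp: points_slit charts_slit chart_at_slit fst_slit_chart)
next
  fix c' assume "c' \<in> charts (slit N)"
  then obtain c where c: "c \<in> charts N" "c' = slit_chart N c" by (auto simp: charts_slit)
  then show "fst c' \<subseteq> points (slit N)" "inj_on (snd c') (fst c')" "open (chart_image c')"
    using chart_subset[OF c(1)] chart_open[OF c(1)] slit_chart_inj[OF c(1)]
    by (auto simp: points_slit fst_slit_chart slit_chart_image intro!: open_Times)
  fix d' assume "d' \<in> charts (slit N)"
  then obtain d where d: "d \<in> charts N" "d' = slit_chart N d" by (auto simp: charts_slit)
  show "smooth_on (snd c' ` (fst c' \<inter> fst d')) (snd d' \<circ> chart_inv c')"
    unfolding c(2) d(2) slit_overlap[OF c(1)] by (rule slit_transition_smooth[OF c(1) d(1)])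
qed

end

context smooth_atlas
begin

interpretation slit: smooth_atlas "slit N"
  by (rule smooth_atlas_slit)

text \<open>A slit transition \<open>(x, y) \<mapsto> (t x, t' x y)\<close> has a block triangular
  derivative: the base component ignores the fibre direction, and vertical vectors transform by
  \<open>t'\<close> alone. Hence \<open>rho\<close> and \<open>gam\<close> keep the same simple form
  in every chart, although the fibre component of a general vector does not.\<close>

lemma slit_transition_derivative:
  assumes "c \<in> charts N" "d \<in> charts N" "p \<in> fst c" "p \<in> fst d" "y \<noteq> 0"
  shows "fst (frechet_derivative (snd (slit_chart N d) \<circ> chart_inv (slit_chart N c)) (at (snd c p, y)) h)
      = frechet_derivative (snd d \<circ> chart_inv c) (at (snd c p)) (fst h)"
    "frechet_derivative (snd (slit_chart N d) \<circ> chart_inv (slit_chart N c)) (at (snd c p, y)) (0, w)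
      = (0, frechet_derivative (snd d \<circ> chart_inv c) (at (snd c p)) w)"
proof -
  let ?U = "snd c ` (fst c \<inter> fst d)" and ?t = "snd d \<circ> chart_inv c"
  let ?x = "snd c p"
  have x: "?x \<in> ?U" using assms by auto
  have o: "open (?U \<times> (- {0::'e}))" "(?x, y) \<in> ?U \<times> (- {0::'e})"
    using overlap_open[OF assms(1,2)] x assms by (auto intro!: open_Times)
  have t: "(?t has_derivative frechet_derivative ?t (at ?x)) (at ?x)"
    by (intro frechet_derivativeD transition_differentiable assms)
  have dt: "((\<lambda>x. frechet_derivative ?t (at x) v) has_derivative
      frechet_derivative (\<lambda>x. frechet_derivative ?t (at x) v) (at ?x)) (at ?x)" for v
    by (intro frechet_derivativeD smooth_on_differentiable[OF smooth_on_derivative[OF transition_smooth[OF assms(1,2)]] x])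
  have dt': "((\<lambda>z. frechet_derivative ?t (at (fst z)) v) has_derivative
     (\<lambda>h. frechet_derivative (\<lambda>x. frechet_derivative ?t (at x) v) (at ?x) (fst h))) (at (?x, y))" for v
    by (rule has_derivative_compose[of fst fst "(?x, y)" UNIV "\<lambda>x. frechet_derivative ?t (at x) v"])
      (simp_all only: fst_conv has_derivative_fst has_derivative_ident dt)
  have 1: "((\<lambda>z. ?t (fst z)) has_derivative (\<lambda>h. frechet_derivative ?t (at ?x) (fst h))) (at (?x, y))"
    by (rule has_derivative_compose[of fst fst "(?x, y)" UNIV ?t])
      (simp_all only: fst_conv has_derivative_fst has_derivative_ident t)
  have 2: "((\<lambda>z. frechet_derivative ?t (at (fst z)) (snd z)) has_derivative
     (\<lambda>h. frechet_derivative (\<lambda>z. frechet_derivative ?t (at (fst z)) (snd (?x, y))) (at (?x, y)) h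
        + frechet_derivative ?t (at (fst (?x, y))) (snd h))) (at (?x, y))"
  proof (rule has_derivative_linear_family[OF o])
    show "linear (frechet_derivative ?t (at (fst z)))" if "z \<in> ?U \<times> (- {0})" for z
      using that linear_transition[OF assms(1,2)] by auto
    show "(\<lambda>z. frechet_derivative ?t (at (fst z)) v) differentiable (at (?x, y))" for v
      using dt' differentiable_def by blast
  qed (auto intro: derivative_eq_intros)
  have "((snd (slit_chart N d) \<circ> chart_inv (slit_chart N c)) has_derivative
     (\<lambda>h. (frechet_derivative ?t (at ?x) (fst h),
        frechet_derivative (\<lambda>x. frechet_derivative ?t (at x) y) (at ?x) (fst h)
          + frechet_derivative ?t (at ?x) (snd h)))) (at (?x, y))"
    using has_derivative_transform_within_open[OF has_derivative_Pair[OF 1 2] o,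
        of "snd (slit_chart N d) \<circ> chart_inv (slit_chart N c)"]
      slit_transition[OF assms(1,2)]
    by (auto simp: frechet_derivative_eqI[OF dt'])
  note D = frechet_derivative_eqI[OF this]
  show "fst (frechet_derivative (snd (slit_chart N d) \<circ> chart_inv (slit_chart N c)) (at (?x, y)) h)
      = frechet_derivative ?t (at ?x) (fst h)"
    by (simp add: D)
  show "frechet_derivative (snd (slit_chart N d) \<circ> chart_inv (slit_chart N c)) (at (?x, y)) (0, w)
      = (0, frechet_derivative ?t (at ?x) w)"
    by (simp add: D linear_0[OF has_derivative_linear[OF t]] linear_0[OF has_derivative_linear[OF dt]])
qed

lemma slit_coords:
  assumes "c \<in> charts N" "u \<in> fst (slit_chart N c)"
  shows fst_slit_coords: "fst (coords (slit N) (slit_chart N c) u \<xi>) = coords N c (fst u) (fst \<xi>)"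
    and slit_coords_vertical: "coords (slit N) (slit_chart N c) u (0, w) = (0, coords N c (fst u) w)"
proof -
  let ?c0 = "chart_at N (fst u)"
  have p: "fst u \<in> fst c" "fst u \<in> points N" "snd u \<noteq> 0"
    using assms chart_subset[OF assms(1)] by (auto simp: fst_slit_chart)
  have u: "snd (slit_chart N ?c0) u = (snd ?c0 (fst u), snd u)"
    using snd_slit_chart[of N ?c0 "fst u" "snd u"] coords_self[OF p(2)] by simp
  note D = slit_transition_derivative[OF chart_at_charts[OF p(2)] assms(1) chart_at_mem[OF p(2)] p(1,3)]
  show "fst (coords (slit N) (slit_chart N c) u \<xi>) = coords N c (fst u) (fst \<xi>)"
    unfolding slit.coords_eq chart_at_slit u D(1) coords_eq ..
  show "coords (slit N) (slit_chart N c) u (0, w) = (0, coords N c (fst u) w)"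
    unfolding slit.coords_eq chart_at_slit u D(2) coords_eq ..
qed

lemma rho_eq:
  assumes "u \<in> points (slit N)"
  shows "rho N u \<xi> = fst \<xi>"
proof -
  let ?c = "chart_at N (fst u)"
  have p: "fst u \<in> points N" "snd u \<noteq> 0" using assms by (auto simp: points_slit)
  note c = chart_at_charts[OF p(1)] chart_at_mem[OF p(1)]
  have u: "snd (slit_chart N ?c) u = (snd ?c (fst u), snd u)"
    using snd_slit_chart[of N ?c "fst u" "snd u"] coords_self[OF p(1)] by simp
  have "frechet_derivative (snd ?c \<circ> fst \<circ> chart_inv (slit_chart N ?c)) (at (snd ?c (fst u), snd u))
      = frechet_derivative fst (at (snd ?c (fst u), snd u))"
  proof (rule frechet_derivative_cong_open[of "chart_image ?c \<times> (- {0})"])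
    show "open (chart_image ?c \<times> (- {0::'e}))" by (intro open_Times chart_open c) auto
    show "(snd ?c (fst u), snd u) \<in> chart_image ?c \<times> (- {0})"
      using chart_image_mem[OF c(2)] p by auto
    show "(snd ?c \<circ> fst \<circ> chart_inv (slit_chart N ?c)) z = fst z" if "z \<in> chart_image ?c \<times> (- {0})" for z
      using slit_chart_inv'[OF c(1) that] that by (simp add: chart_inv_right mem_Times_iff)
  qed
  also have "\<dots> = fst"
    by (intro frechet_derivative_eqI bounded_linear_imp_has_derivative bounded_linear_fst)
  finally show ?thesis
    by (simp add: rho_def tangent_map_def dir_deriv_def chart_at_slit u)
qed

lemma gam_eq:
  assumes "u \<in> points (slit N)"
  shows "gam N u v = (0, v)"
proof -
  let ?c = "chart_at N (fst u)"
  have p: "fst u \<in> points N" using assms by (auto simp: points_slit)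
  have eq: "snd (slit_chart N ?c) \<circ> (\<lambda>t. (fst u, snd u + t *\<^sub>R v))
      = (\<lambda>t. (snd ?c (fst u), snd u + t *\<^sub>R v))"
    by (auto simp: snd_slit_chart coords_self[OF p])
  have "((\<lambda>t. (snd ?c (fst u), snd u + t *\<^sub>R v)) has_vector_derivative (0, v)) (at 0)"
    unfolding has_vector_derivative_def by (auto intro!: derivative_eq_intros)
  then show ?thesis
    by (simp add: gam_def curve_velocity_def chart_at_slit eq vector_derivative_at)
qed

lemma smooth_pi_fieldD:
  "smooth_pi_field N Z \<Longrightarrow> c \<in> charts N \<Longrightarrow>
    smooth_on (chart_image (slit_chart N c)) ((\<lambda>u. coords N c (fst u) (Z u)) \<circ> chart_inv (slit_chart N c))"
  by (simp add: smooth_pi_field_def)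

lemma slit_chart_inv_points:
  "c \<in> charts N \<Longrightarrow> x \<in> chart_image (slit_chart N c) \<Longrightarrow> chart_inv (slit_chart N c) x \<in> points (slit N)"
  using slit.chart_inv_points by (auto simp: charts_slit)

lemma smooth_pi_field_cong:
  assumes "smooth_pi_field N Z" "\<And>u. u \<in> points (slit N) \<Longrightarrow> Z u = W u"
  shows "smooth_pi_field N W"
  unfolding smooth_pi_field_def
  by (intro ballI smooth_on_cong[OF smooth_pi_fieldD[OF assms(1)]]) (use assms(2) slit_chart_inv_points in auto)

lemma open_slit_chart_image: "c \<in> charts N \<Longrightarrow> open (chart_image (slit_chart N c))"
  by (rule slit.chart_open) (simp add: charts_slit)

lemma smooth_pi_field_eta: "smooth_pi_field N eta"
  unfolding smooth_pi_field_def
proof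
  fix c assume c: "c \<in> charts N"
  show "smooth_on (chart_image (slit_chart N c))
      ((\<lambda>u. coords N c (fst u) (eta u)) \<circ> chart_inv (slit_chart N c))"
  proof (rule smooth_on_cong[OF smooth_on_linear[OF open_slit_chart_image[OF c] bounded_linear_snd]])
    fix x assume "x \<in> chart_image (slit_chart N c)"
    then show "snd x = ((\<lambda>u. coords N c (fst u) (eta u)) \<circ> chart_inv (slit_chart N c)) x"
      by (cases x) (auto simp: slit_chart_image[OF c] slit_chart_inv[OF c] eta_def coords_uncoords[OF c] chart_inv_mem)
  qed
qed

lemma smooth_on_base:
  assumes "c \<in> charts N" "smooth_on (chart_image c) g"
  shows "smooth_on (chart_image (slit_chart N c)) (\<lambda>x. g (fst x))"
  by (rule smooth_on_compose[OF smooth_on_linear[OF open_slit_chart_image[OF assms(1)] bounded_linear_fst] assms(2)])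
    (auto simp: slit_chart_image[OF assms(1)])

lemma smooth_pi_field_base:
  assumes "smooth_vector_field N V"
  shows "smooth_pi_field N (\<lambda>u. V (fst u))"
  unfolding smooth_pi_field_def
proof
  fix c assume c: "c \<in> charts N"
  have "smooth_on (chart_image c) (field_in_chart N V c)"
    using assms c by (simp add: smooth_vector_field_def)
  from smooth_on_base[OF c this]
  show "smooth_on (chart_image (slit_chart N c))
      ((\<lambda>u. coords N c (fst u) (V (fst u))) \<circ> chart_inv (slit_chart N c))"
    by (rule smooth_on_cong)
      (simp add: slit_chart_image[OF c] slit_chart_inv'[OF c] field_in_chart_def)
qed

lemma smooth_fun_base:
  assumes "smooth_fun N \<psi>"
  shows "smooth_fun (slit N) (\<lambda>u. \<psi> (fst u))"
  unfolding smooth_fun_def charts_slit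
proof
  fix c' assume "c' \<in> slit_chart N ` charts N"
  then obtain c where c: "c \<in> charts N" and c': "c' = slit_chart N c" by blast
  from smooth_on_base[OF c smooth_funD[OF assms c]]
  show "smooth_on (chart_image c') ((\<lambda>u. \<psi> (fst u)) \<circ> chart_inv c')"
    unfolding c' by (rule smooth_on_cong) (simp add: slit_chart_image[OF c] slit_chart_inv'[OF c])
qed

lemma cutoff_slit:
  assumes "c \<in> charts N" "cutoff N c \<psi>"
  shows "cutoff (slit N) (slit_chart N c) (\<lambda>u. \<psi> (fst u))"
proof -
  obtain K where K: "K \<subseteq> fst c" "\<And>d. d \<in> charts N \<Longrightarrow> open (snd d ` (fst d - K))"
    "\<And>p. p \<in> points N - K \<Longrightarrow> \<psi> p = 0" and s: "smooth_fun N \<psi>"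
    using assms by (auto simp: cutoff_def)
  have eq: "snd (slit_chart N d) ` (fst (slit_chart N d) - K \<times> (- {0})) = snd d ` (fst d - K) \<times> (- {0})"
    if d: "d \<in> charts N" for d
  proof (intro equalityI subsetI)
    fix z assume "z \<in> snd (slit_chart N d) ` (fst (slit_chart N d) - K \<times> (- {0}))"
    then obtain p v where "p \<in> fst d" "p \<notin> K" "v \<noteq> 0" "z = snd (slit_chart N d) (p, v)"
      by (auto simp: fst_slit_chart)
    then show "z \<in> snd d ` (fst d - K) \<times> (- {0})"
      using coords_eq_0_iff[OF d] by (simp add: snd_slit_chart)
  next
    fix z :: "'e \<times> 'e" assume "z \<in> snd d ` (fst d - K) \<times> (- {0})"
    then obtain p y where z: "z = (snd d p, y)" and p: "p \<in> fst d" "p \<notin> K" and y: "y \<noteq> 0" by auto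
    have "(snd d p, y) = snd (slit_chart N d) (p, uncoords N d p y)"
      using p by (simp add: snd_slit_chart coords_uncoords[OF d])
    moreover have "(p, uncoords N d p y) \<in> fst (slit_chart N d) - K \<times> (- {0})"
      using p uncoords_eq_0_iff[OF d] y by (simp add: fst_slit_chart)
    ultimately show "z \<in> snd (slit_chart N d) ` (fst (slit_chart N d) - K \<times> (- {0}))"
      unfolding z by (rule image_eqI)
  qed
  have "open (snd d' ` (fst d' - K \<times> (- {0})))" if "d' \<in> charts (slit N)" for d'
    using that K(2) by (auto simp del: split_paired_All split_paired_Ex simp: charts_slit eq intro!: open_Times)
  moreover have "\<psi> (fst u) = 0" if "u \<in> points (slit N) - K \<times> (- {0})" for u
    using that by (intro K(3)) (auto simp: points_slit)
  ultimately show ?thesis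
    unfolding cutoff_def using K(1) smooth_fun_base[OF s]
    by (intro conjI exI[of _ "K \<times> (- {0})"]) (auto simp: fst_slit_chart)
qed

end

subsection \<open>Cutoff functions and locality of connections\<close>

text \<open>The classical flat function \<open>exp (-1/t)\<close>, with a power of \<open>t\<close>
  in the denominator so that the family is closed under differentiation up to linear
  combinations.\<close>

definition flat :: "nat \<Rightarrow> real \<Rightarrow> real" where
  "flat n t = (if t \<le> 0 then 0 else exp (- (1 / t)) / t ^ n)"

lemma flat_tendsto_0: "((\<lambda>t::real. exp (- (1 / t)) / t ^ n) \<longlongrightarrow> 0) (at_right 0)"
proof -
  have "((\<lambda>t::real. inverse t ^ n / exp (inverse t)) \<longlongrightarrow> 0) (at_right 0)"
    by (rule filterlim_compose[OF tendsto_power_div_exp_0 filterlim_inverse_at_top_right])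
  moreover have "inverse t ^ n / exp (inverse t) = exp (- (1 / t)) / t ^ n" for t :: real
    by (simp add: exp_minus field_simps power_inverse)
  ultimately show ?thesis by simp
qed

lemma flat_has_derivative:
  "(flat n has_real_derivative flat (n + 2) t - real n * flat (n + 1) t) (at t)"
proof (cases t "0 :: real" rule: linorder_cases)
  case less
  have "(flat n has_real_derivative 0) (at t)"
    by (rule has_field_derivative_transform_within_open[of "\<lambda>_. 0" _ _ "{..<0}"])
      (use less in \<open>auto simp: flat_def\<close>)
  then show ?thesis using less by (simp add: flat_def)
next
  case equal
  \<comment> \<open>For positive \<open>h\<close> the difference quotient at 0 is again a member of
    the family, with index \<open>Suc n\<close>.\<close>
  have r: "((\<lambda>h. flat n h / h) \<longlongrightarrow> 0) (at_right 0)"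
  proof (rule Lim_transform_eventually[OF flat_tendsto_0[of "Suc n"]])
    show "\<forall>\<^sub>F h in at_right 0. exp (- (1 / h)) / h ^ Suc n = flat n h / h"
      by (auto simp: flat_def eventually_at_filter)
  qed
  have l: "((\<lambda>h. flat n h / h) \<longlongrightarrow> 0) (at_left 0)"
  proof (rule Lim_transform_eventually[OF tendsto_const])
    show "\<forall>\<^sub>F h in at_left 0. 0 = flat n h / h"
      by (auto simp: flat_def eventually_at_filter)
  qed
  have "(flat n has_real_derivative 0) (at 0)"
    using filterlim_split_at[OF l r] by (simp add: has_field_derivative_iff flat_def)
  then show ?thesis using equal by (simp add: flat_def)
next
  case greater
  have "((\<lambda>t. exp (- (1 / t)) / t ^ n) has_real_derivative
      exp (- (1 / t)) / t ^ (n + 2) - real n * (exp (- (1 / t)) / t ^ (n + 1))) (at t)"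
    using greater
    by (auto intro!: derivative_eq_intros simp: field_simps power2_eq_square)
      (cases n; simp add: field_simps power2_eq_square)
  then have "(flat n has_real_derivative
      exp (- (1 / t)) / t ^ (n + 2) - real n * (exp (- (1 / t)) / t ^ (n + 1))) (at t)"
    by (rule has_field_derivative_transform_within_open[of _ _ _ "{0<..}"])
      (use greater in \<open>auto simp: flat_def\<close>)
  then show ?thesis using greater by (simp add: flat_def)
qed

lemma Ck_on_real_derivative:
  fixes f :: "real \<Rightarrow> real"
  assumes "open S" "\<And>x. x \<in> S \<Longrightarrow> (f has_real_derivative f' x) (at x)" "Ck_on k S f'"
  shows "Ck_on (Suc k) S f"
proof -
  have d: "f differentiable (at x)" "frechet_derivative f (at x) = (\<lambda>v. v * f' x)" if "x \<in> S" for x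
    using assms(2)[OF that] frechet_derivative_eqI
    by (auto simp: has_field_derivative_def mult_commute_abs differentiable_def)
  have "Ck_on k S (\<lambda>x. frechet_derivative f (at x) v)" for v
    by (rule Ck_on_cong[OF assms(1) _ Ck_on_scaleR[OF assms(1) Ck_on_const assms(3), of v]])
      (simp add: d)
  then show ?thesis using d by simp
qed

lemma smooth_on_flat: "smooth_on UNIV (flat n)"
proof (rule smooth_onI)
  show "Ck_on k UNIV (flat n)" for k
  proof (induction k arbitrary: n)
    case 0
    show ?case
      unfolding Ck_on.simps
      by (intro continuous_at_imp_continuous_on ballI DERIV_isCont[OF flat_has_derivative])
  next
    case (Suc k)
    have "Ck_on k UNIV (\<lambda>t. flat (n + 2) t + (- real n) *\<^sub>R flat (n + 1) t)"
      by (intro Ck_on_add Ck_on_scaleR Ck_on_const Suc open_UNIV)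
    then show ?case
      by (intro Ck_on_real_derivative[OF open_UNIV flat_has_derivative]) simp
  qed
qed simp

text \<open>Meant for the factor \<open>L powr (- r)\<close> with real \<open>r\<close>. The
  induction covers all exponents at once because differentiation lowers the exponent.\<close>

lemma smooth_on_powr: "smooth_on {0<..} (\<lambda>x::real. x powr a)"
proof (rule smooth_onI)
  show "Ck_on k {0<..} (\<lambda>x::real. x powr a)" for k
  proof (induction k arbitrary: a)
    case 0
    show ?case unfolding Ck_on.simps by (intro continuous_intros) auto
  next
    case (Suc k)
    have "Ck_on k {0<..} (\<lambda>x::real. a *\<^sub>R x powr (a - 1))"
      by (intro Ck_on_scaleR Ck_on_const Suc open_greaterThan)
    moreover have "((\<lambda>x. x powr a) has_real_derivative a *\<^sub>R x powr (a - 1)) (at x)"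
      if "x \<in> {0<..}" for x
      using that by (auto intro!: derivative_eq_intros simp: powr_diff)
    ultimately show ?case
      by (intro Ck_on_real_derivative[OF open_greaterThan])
  qed
qed simp

lemma
  assumes "linear_connection M D"
  shows linear_connection_linear:
      "u \<in> points (slit M) \<Longrightarrow> smooth_pi_field M Z \<Longrightarrow> linear (\<lambda>\<xi>. D u \<xi> Z)"
    and linear_connection_leibniz:
      "u \<in> points (slit M) \<Longrightarrow> smooth_fun (slit M) f \<Longrightarrow> smooth_pi_field M Z \<Longrightarrow>
        D u \<xi> (\<lambda>w. f w *\<^sub>R Z w) = dir_deriv (slit M) f u \<xi> *\<^sub>R Z u + f u *\<^sub>R D u \<xi> Z"
    and linear_connection_smooth:
      "smooth_vector_field (slit M) X \<Longrightarrow> smooth_pi_field M Z \<Longrightarrow> smooth_pi_field M (\<lambda>u. D u (X u) Z)"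
  using assms unfolding linear_connection_def by blast+

lemma smooth_bump_exists:
  fixes a :: "'e::euclidean_space"
  assumes "e > 0"
  shows "\<exists>B. smooth_on UNIV B \<and> (\<forall>x\<in>ball a e. B x = (1::real)) \<and> (\<forall>x. x \<notin> cball a (2 * e) \<longrightarrow> B x = 0)"
proof -
  define q where "q = (\<lambda>x. (\<Sum>i\<in>Basis. ((x - a) \<bullet> i) *\<^sub>R ((x - a) \<bullet> i)))"
  have q: "q x = (dist a x)\<^sup>2" for x
    unfolding q_def dist_norm norm_minus_commute[of a] power2_norm_eq_inner euclidean_inner[of "x - a" "x - a"]
    by simp
  have "smooth_on UNIV (\<lambda>x. (x - a) \<bullet> i)" for i
    using smooth_on_add[OF smooth_on_linear[OF open_UNIV bounded_linear_inner_left] smooth_on_const[OF open_UNIV, of "- a \<bullet> i"], of i]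
    by (simp add: inner_diff_left)
  then have sq: "smooth_on UNIV q"
    unfolding q_def by (intro smooth_on_sum smooth_on_scaleR open_UNIV)
  \<comment> \<open>\<open>h\<close> is at most 0 within distance \<open>e\<close> and at least 3,
    which is \<open>2\<^sup>2 - 1\<close>, beyond \<open>2 * e\<close>. So \<open>k\<close> equals 1
    inside and is at most 0 outside, and the second use of \<open>flat\<close> makes the outer value
    exactly 0.\<close>
  define h where "h = (\<lambda>x. (1 / e\<^sup>2) *\<^sub>R q x + - 1)"
  have sh: "smooth_on UNIV h"
    unfolding h_def by (intro smooth_on_add smooth_on_scaleR smooth_on_const sq open_UNIV)
  define k where "k = (\<lambda>x. 1 + (- (1 / flat 0 3)) *\<^sub>R flat 0 (h x))"
  have sk: "smooth_on UNIV k"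
    unfolding k_def
    by (intro smooth_on_add smooth_on_scaleR smooth_on_const open_UNIV
        smooth_on_compose[OF sh smooth_on_flat]) simp
  define B where "B = (\<lambda>x. (1 / flat 0 1) *\<^sub>R flat 0 (k x))"
  have sB: "smooth_on UNIV B"
    unfolding B_def
    by (intro smooth_on_scaleR smooth_on_const open_UNIV smooth_on_compose[OF sk smooth_on_flat]) simp
  have "B x = 1" if "x \<in> ball a e" for x
  proof -
    have "(dist a x)\<^sup>2 \<le> e\<^sup>2" using that by (intro power_mono) auto
    then have "h x \<le> 0" using assms by (simp add: h_def q field_simps)
    then have "k x = 1" by (simp add: k_def flat_def)
    then show ?thesis by (simp add: B_def flat_def)
  qed
  moreover have "B x = 0" if "x \<notin> cball a (2 * e)" for x
  proof -
    have "(2 * e)\<^sup>2 \<le> (dist a x)\<^sup>2" using that assms by (intro power_mono) auto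
    then have "3 \<le> h x" using assms by (simp add: h_def q field_simps)
    then have "flat 0 3 \<le> flat 0 (h x)" by (simp add: flat_def frac_le)
    then have "1 \<le> flat 0 (h x) / flat 0 3" by (simp add: flat_def)
    then have "k x \<le> 0" by (simp add: k_def)
    then show ?thesis by (simp add: B_def flat_def)
  qed
  ultimately show ?thesis using sB by blast
qed

section \<open>Cutoff functions on a manifold\<close>

lemma smooth_manifold_atlas:
  assumes "smooth_manifold X M"
  shows "smooth_atlas M"
proof
  fix c assume c: "c \<in> charts M"
  have o: "openin X (fst c)" and h: "homeomorphic_map (subtopology X (fst c)) (top_of_set (chart_image c)) (snd c)"
    and t: "topspace X = points M"
    using assms c unfolding smooth_manifold_def by blast+
  show sub: "fst c \<subseteq> points M" using openin_subset[OF o] t by simp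
  show "inj_on (snd c) (fst c)"
    using homeomorphic_imp_injective_map[OF h] sub t by (simp add: Int_absorb1)
  show "open (chart_image c)" using assms c unfolding smooth_manifold_def by blast
  fix d assume "d \<in> charts M"
  then show "smooth_on (snd c ` (fst c \<inter> fst d)) (snd d \<circ> chart_inv c)"
    using assms c unfolding smooth_manifold_def by blast
next
  fix p assume "p \<in> points M"
  then show "chart_at M p \<in> charts M" "p \<in> fst (chart_at M p)"
    using assms unfolding smooth_manifold_def by blast+
qed

text \<open>The preimage \<open>K\<close> of a closed coordinate ball is compact, hence closed since
  \<open>X\<close> is Hausdorff. Its complement is therefore open in every chart, and the bump
  function of the chart extends smoothly by zero.\<close>

lemma cutoff_exists:
  fixes M :: "('a, 'e::euclidean_space) charted_space"
  assumes man: "smooth_manifold X M" and c: "c \<in> charts M" and p: "p \<in> fst c"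
  shows "\<exists>\<psi> e. cutoff M c \<psi> \<and> e > 0 \<and> ball (snd c p) e \<subseteq> chart_image c \<and>
    (\<forall>x\<in>ball (snd c p) e. \<psi> (chart_inv c x) = 1)"
proof -
  interpret smooth_atlas M by (rule smooth_manifold_atlas[OF man])
  let ?a = "snd c p"
  have t: "topspace X = points M" and haus: "Hausdorff_space X"
    using man unfolding smooth_manifold_def by blast+
  have o: "openin X (fst d)" and h: "homeomorphic_map (subtopology X (fst d)) (top_of_set (chart_image d)) (snd d)"
    if "d \<in> charts M" for d
    using man that unfolding smooth_manifold_def by blast+
  have ts: "topspace (subtopology X (fst d)) = fst d" if "d \<in> charts M" for d
    using chart_subset[OF that] t by (simp add: Int_absorb1)
  obtain e' where e': "e' > 0" "cball ?a e' \<subseteq> chart_image c"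
    using chart_open[OF c] chart_image_mem[OF p] open_contains_cball by metis
  \<comment> \<open>Halved because the bump vanishes only beyond \<open>2 * e\<close>, and that
    larger closed ball must still lie in the chart.\<close>
  define e where "e = e' / 2"
  have e: "e > 0" "cball ?a (2 * e) \<subseteq> chart_image c" using e' by (auto simp: e_def)
  obtain B where B: "smooth_on UNIV B" "\<And>x. x \<in> ball ?a e \<Longrightarrow> B x = (1::real)"
    "\<And>x. x \<notin> cball ?a (2 * e) \<Longrightarrow> B x = 0"
    using smooth_bump_exists[OF e(1), of ?a] by metis
  define K where "K = {q \<in> fst c. snd c q \<in> cball ?a (2 * e)}"
  define \<psi> where "\<psi> = (\<lambda>q. if q \<in> fst c then B (snd c q) else 0)"
  have Kc: "K \<subseteq> fst c" by (auto simp: K_def)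
  have img: "snd c ` K = cball ?a (2 * e)"
  proof (intro equalityI subsetI)
    fix x assume x: "x \<in> cball ?a (2 * e)"
    then have "x \<in> chart_image c" using e by auto
    then show "x \<in> snd c ` K"
      using x by (intro image_eqI[of _ _ "chart_inv c x"]) (auto simp: K_def chart_inv_right chart_inv_mem)
  qed (auto simp: K_def)
  have "compactin (top_of_set (chart_image c)) (snd c ` K)"
    using e(2) by (simp add: img compactin_subtopology)
  then have "compactin (subtopology X (fst c)) K"
    using homeomorphic_map_compactness[OF h[OF c], of K] Kc chart_subset[OF c] t
    by (simp add: order_trans)
  then have "closedin X K"
    by (simp add: compactin_subtopology compactin_imp_closedin[OF haus])
  then have "openin (subtopology X (fst d)) (fst d - K)" if "d \<in> charts M" for d
    using openin_diff[OF o[OF that]] by (simp add: openin_open_subtopology[OF o[OF that]])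
  then have open_diff: "open (snd d ` (fst d - K))" if "d \<in> charts M" for d
    using homeomorphic_map_openness[OF h[OF that], of "fst d - K"] ts[OF that] that
      openin_open_eq[OF chart_open[OF that]] by auto
  have \<psi>0: "\<psi> q = 0" if "q \<in> points M - K" for q
    using that B(3) by (auto simp: \<psi>_def K_def)
  have "smooth_fun M \<psi>"
    unfolding smooth_fun_def
  proof
    fix d assume d: "d \<in> charts M"
    let ?A = "snd d ` (fst d \<inter> fst c)" and ?B = "snd d ` (fst d - K)"
    have "chart_image d = ?A \<union> ?B" using Kc by (auto simp: chart_image_def)
    moreover have "smooth_on ?A (\<psi> \<circ> chart_inv d)"
      by (rule smooth_on_cong[OF smooth_on_compose[OF transition_smooth[OF d c] B(1)]])
        (auto simp: \<psi>_def chart_inv_left[OF d])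
    moreover have "smooth_on ?B (\<psi> \<circ> chart_inv d)"
      by (rule smooth_on_cong[OF smooth_on_const[OF open_diff[OF d], of 0]])
        (use \<psi>0 chart_subset[OF d] in \<open>auto simp: chart_inv_left[OF d]\<close>)
    ultimately show "smooth_on (chart_image d) (\<psi> \<circ> chart_inv d)"
      using smooth_on_Un by simp
  qed
  then have "cutoff M c \<psi>"
    unfolding cutoff_def using Kc open_diff \<psi>0 by blast
  moreover have sub: "ball ?a e \<subseteq> chart_image c"
    using e by (intro order_trans[OF _ e(2)]) auto
  moreover have "\<psi> (chart_inv c x) = 1" if "x \<in> ball ?a e" for x
    using that sub chart_inv_mem[of x c] chart_inv_right[of x c] B(2)[OF that] by (auto simp: \<psi>_def)
  ultimately show ?thesis using e(1) by blast
qed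

section \<open>Independence of covariant derivatives from values off the slit bundle\<close>

context smooth_atlas
begin

interpretation slit: smooth_atlas "slit N"
  by (rule smooth_atlas_slit)

lemma smooth_pi_field_0: "smooth_pi_field N (\<lambda>u. 0)"
  unfolding smooth_pi_field_def
proof
  fix c assume c: "c \<in> charts N"
  show "smooth_on (chart_image (slit_chart N c)) ((\<lambda>u. coords N c (fst u) 0) \<circ> chart_inv (slit_chart N c))"
  proof (rule smooth_on_cong[OF smooth_on_const[OF open_slit_chart_image[OF c], of 0]])
    fix x assume "x \<in> chart_image (slit_chart N c)"
    then have "fst (chart_inv (slit_chart N c) x) \<in> fst c"
      using slit_chart_inv'[OF c] chart_inv_mem[of "fst x" c] by (simp add: slit_chart_image[OF c] mem_Times_iff)
    then show "0 = ((\<lambda>u. coords N c (fst u) 0) \<circ> chart_inv (slit_chart N c)) x"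
      by (simp add: linear_0[OF linear_coords[OF c]])
  qed
qed

text \<open>Values of a field off the slit bundle are junk.  They do not matter: by the Leibniz rule,
  multiplication by the indicator of the slit bundle does not change the covariant derivative.\<close>

lemma connection_cong:
  assumes "linear_connection N D" "u \<in> points (slit N)" "smooth_pi_field N Z"
    and eq: "\<And>w. w \<in> points (slit N) \<Longrightarrow> Z w = W w"
  shows "D u \<xi> Z = D u \<xi> W"
proof -
  define f where "f = (\<lambda>w. if w \<in> points (slit N) then 1 else (0::real))"
  have W: "smooth_pi_field N W" using smooth_pi_field_cong[OF assms(3) eq] .
  have one: "smooth_fun (slit N) (\<lambda>w. 1::real)"
    by (auto simp: smooth_fun_def comp_def intro!: smooth_on_const slit.chart_open)
  have f: "smooth_fun (slit N) f"
    by (rule slit.smooth_fun_cong[OF one]) (simp add: f_def)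
  have "dir_deriv (slit N) f u = dir_deriv (slit N) (\<lambda>w. 1) u"
    by (rule slit.dir_deriv_cong[OF assms(2)]) (simp add: f_def)
  then have df: "dir_deriv (slit N) f u \<xi> = 0"
    by (simp add: dir_deriv_def comp_def)
  have L: "D u \<xi> (\<lambda>w. f w *\<^sub>R V w) = D u \<xi> V" if "smooth_pi_field N V" for V
    using linear_connection_leibniz[OF assms(1,2) f that, of \<xi>] df assms(2) by (simp add: f_def)
  have "(\<lambda>w. f w *\<^sub>R Z w) = (\<lambda>w. f w *\<^sub>R W w)"
    using eq by (auto simp: f_def)
  then show ?thesis using L[OF W] L[OF assms(3)] by metis
qed

text \<open>Additivity on \<open>0 + 0\<close> forces the zero field to have zero derivative. The
  form given here serves fields such as \<open>K (\<beta> Z)\<close>, which are known to vanish on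
  the slit bundle only.\<close>

lemma connection_0:
  assumes "linear_connection N D" "u \<in> points (slit N)" "\<And>w. w \<in> points (slit N) \<Longrightarrow> Z w = 0"
  shows "D u \<xi> Z = 0"
proof -
  have "D u \<xi> (\<lambda>w. 0 + 0) = D u \<xi> (\<lambda>w. 0) + D u \<xi> (\<lambda>w. 0)"
    using assms(1,2) smooth_pi_field_0 unfolding linear_connection_def by blast
  then have "D u \<xi> (\<lambda>w. 0) = 0" by simp
  then show ?thesis
    using connection_cong[OF assms(1,2) smooth_pi_field_0, of Z \<xi>] assms(3) by simp
qed

end

subsection \<open>Cartan connections\<close>

lemma homogeneous_euler:
  fixes F :: "'e::real_normed_vector \<Rightarrow> real"
  assumes "F differentiable (at y)" "\<And>t. t > 0 \<Longrightarrow> F (t *\<^sub>R y) = t powr r * F y"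
  shows "frechet_derivative F (at y) y = r * F y"
proof -
  have F: "(F has_derivative frechet_derivative F (at y)) (at (1 *\<^sub>R y))"
    using frechet_derivativeD[OF assms(1)] by simp
  have 1: "((\<lambda>t. F (t *\<^sub>R y)) has_derivative (\<lambda>h. frechet_derivative F (at y) (h *\<^sub>R y))) (at 1)"
    by (rule has_derivative_compose[where f="\<lambda>t. t *\<^sub>R y" and g=F, OF _ F]) (auto intro!: derivative_eq_intros)
  have "((\<lambda>t. t powr r * F y) has_real_derivative r * F y) (at 1)"
    by (auto intro!: derivative_eq_intros)
  then have 2: "((\<lambda>t. t powr r * F y) has_derivative (*) (r * F y)) (at 1)"
    by (simp add: has_field_derivative_def)
  have "((\<lambda>t. F (t *\<^sub>R y)) has_derivative (*) (r * F y)) (at 1)"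
    by (rule has_derivative_transform_within_open[OF 2, of "{0<..}"]) (auto simp: assms(2))
  from has_derivative_unique[OF 1 this] show ?thesis
    by (metis mult.right_neutral scaleR_one)
qed

lemma homogeneous_derivative:
  fixes F :: "'e::real_normed_vector \<Rightarrow> real"
  assumes "F differentiable (at y)" "F differentiable (at (t *\<^sub>R y))" "y \<noteq> 0" "t > 0"
    "\<And>z. z \<noteq> 0 \<Longrightarrow> F (t *\<^sub>R z) = t powr r * F z"
  shows "t * frechet_derivative F (at (t *\<^sub>R y)) w = t powr r * frechet_derivative F (at y) w"
proof -
  have 1: "((\<lambda>z. F (t *\<^sub>R z)) has_derivative (\<lambda>h. frechet_derivative F (at (t *\<^sub>R y)) (t *\<^sub>R h))) (at y)"
    by (rule has_derivative_compose[where f="\<lambda>z. t *\<^sub>R z" and g=F, OF _ frechet_derivativeD[OF assms(2)]])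
      (auto intro!: derivative_eq_intros)
  have 2: "((\<lambda>z. t powr r * F z) has_derivative (\<lambda>h. t powr r * frechet_derivative F (at y) h)) (at y)"
    by (intro has_derivative_mult_right frechet_derivativeD assms)
  have "((\<lambda>z. F (t *\<^sub>R z)) has_derivative (\<lambda>h. t powr r * frechet_derivative F (at y) h)) (at y)"
    by (rule has_derivative_transform_within_open[OF 2, of "- {0}"]) (use assms in auto)
  from has_derivative_unique[OF 1 this]
  have "frechet_derivative F (at (t *\<^sub>R y)) (t *\<^sub>R w) = t powr r * frechet_derivative F (at y) w"
    by metis
  then show ?thesis
    by (simp add: linear_cmul[OF linear_frechet_derivative[OF assms(2)]])
qed

text \<open>The two slots have separate arguments. In one, Euler's theorem is applied to the first
  derivative, which has degree 1; in the other, Euler's identity \<open>e' z z = 2 * e z\<close> is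
  itself differentiated.\<close>

lemma homogeneous_hessian:
  fixes e :: "'e::euclidean_space \<Rightarrow> real"
  assumes s: "smooth_on (- {0}) e" and h: "\<And>y t. y \<noteq> 0 \<Longrightarrow> t > 0 \<Longrightarrow> e (t *\<^sub>R y) = t powr 2 * e y"
    and y: "y \<noteq> 0"
  shows "frechet_derivative (\<lambda>y. frechet_derivative e (at y) w) (at y) y = frechet_derivative e (at y) w"
    and "frechet_derivative (\<lambda>z. frechet_derivative e (at z) y) (at y) v = frechet_derivative e (at y) v"
proof -
  have d: "e differentiable (at z)" if "z \<noteq> 0" for z
    using smooth_on_differentiable[OF s] that by simp
  have dd: "(\<lambda>y. frechet_derivative e (at y) w) differentiable (at z)" if "z \<noteq> 0" for z w
    using smooth_on_differentiable[OF smooth_on_derivative[OF s]] that by simp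
  have "frechet_derivative (\<lambda>y. frechet_derivative e (at y) w) (at y) y = 1 * frechet_derivative e (at y) w"
  proof (rule homogeneous_euler[OF dd[OF y]])
    fix t :: real assume t: "t > 0"
    have "t * frechet_derivative e (at (t *\<^sub>R y)) w = t powr 2 * frechet_derivative e (at y) w"
      by (rule homogeneous_derivative) (use t y h d in auto)
    then show "frechet_derivative e (at (t *\<^sub>R y)) w = t powr 1 * frechet_derivative e (at y) w"
      using t by (simp add: power2_eq_square)
  qed
  then show "frechet_derivative (\<lambda>y. frechet_derivative e (at y) w) (at y) y = frechet_derivative e (at y) w"
    by simp
  let ?H = "\<lambda>h. frechet_derivative (\<lambda>z. frechet_derivative e (at z) y) (at y) h"
  have 1: "((\<lambda>z. frechet_derivative e (at z) z) has_derivative (\<lambda>h. ?H h + frechet_derivative e (at y) h)) (at y)"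
    by (rule has_derivative_linear_family[of "- {0}"])
      (use y dd d in \<open>auto intro: linear_frechet_derivative derivative_eq_intros\<close>)
  have 2: "((\<lambda>z. 2 * e z) has_derivative (\<lambda>h. 2 * frechet_derivative e (at y) h)) (at y)"
    by (intro has_derivative_mult_right frechet_derivativeD d y)
  have "((\<lambda>z. frechet_derivative e (at z) z) has_derivative (\<lambda>h. 2 * frechet_derivative e (at y) h)) (at y)"
    by (rule has_derivative_transform_within_open[OF 2, of "- {0}"])
      (use y homogeneous_euler[OF d h] in auto)
  from has_derivative_unique[OF 1 this]
  have "?H v + frechet_derivative e (at y) v = 2 * frechet_derivative e (at y) v" by metis
  then show "?H v = frechet_derivative e (at y) v" by simp
qed

lemma fst_frechet_derivative:
  assumes "F differentiable (at x)"
  shows "fst (frechet_derivative F (at x) h) = frechet_derivative (\<lambda>x. fst (F x)) (at x) h"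
  using frechet_derivative_eqI[OF has_derivative_fst[OF frechet_derivativeD[OF assms]]] by simp

section \<open>Functions and fields on the slit bundle in charts\<close>

context smooth_atlas
begin

lemma uncoords_self: "p \<in> points N \<Longrightarrow> uncoords N (chart_at N p) p v = v"
  unfolding uncoords_def using frechet_derivative_id_chart[OF chart_at_charts chart_at_mem] by metis

lemma dir_deriv_field:
  assumes "smooth_fun N f" "d \<in> charts N" "x \<in> chart_image d"
  shows "dir_deriv N f (chart_inv d x) (V (chart_inv d x))
    = frechet_derivative (f \<circ> chart_inv d) (at x) (field_in_chart N V d x)"
  using dir_deriv_chart[OF assms(2) chart_inv_mem[OF assms(3)]
      smooth_fun_differentiable[OF assms(1,2) chart_inv_mem[OF assms(3)]]]
  by (simp add: chart_inv_right[OF assms(3)] field_in_chart_def)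

lemma smooth_vector_fieldD:
  "smooth_vector_field N V \<Longrightarrow> c \<in> charts N \<Longrightarrow> smooth_on (chart_image c) (field_in_chart N V c)"
  by (simp add: smooth_vector_field_def)

lemma smooth_fun_dir_deriv:
  assumes "smooth_fun N f" "smooth_vector_field N V"
  shows "smooth_fun N (\<lambda>p. dir_deriv N f p (V p))"
  unfolding smooth_fun_def
proof
  fix d assume d: "d \<in> charts N"
  show "smooth_on (chart_image d) ((\<lambda>p. dir_deriv N f p (V p)) \<circ> chart_inv d)"
  proof (rule smooth_on_cong)
    show "smooth_on (chart_image d) (\<lambda>x. frechet_derivative (f \<circ> chart_inv d) (at x) (field_in_chart N V d x))"
      by (rule smooth_on_linear_family[OF smooth_on_derivative[OF smooth_funD[OF assms(1) d]]
            _ smooth_vector_fieldD[OF assms(2) d]])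
        (intro linear_frechet_derivative smooth_on_differentiable[OF smooth_funD[OF assms(1) d]])
  qed (simp add: dir_deriv_field[OF assms(1) d])
qed

lemma linear_dir_deriv:
  assumes "smooth_fun N f" "p \<in> points N"
  shows "linear (dir_deriv N f p)"
  unfolding dir_deriv_def
  by (intro linear_frechet_derivative smooth_fun_differentiable[OF assms(1)] chart_at_charts chart_at_mem assms(2))

lemma const_field_value:
  assumes "p \<in> points N" "\<psi> p = 1"
  shows "const_field N (chart_at N p) \<psi> z p = z"
  using assms chart_at_mem[OF assms(1)] by (simp add: const_field_def uncoords_self)

lemma coords_const_field:
  assumes "c \<in> charts N" "p \<in> fst c" "\<psi> p = 1"
  shows "coords N c p (const_field N c \<psi> z p) = z"
  using assms by (simp add: const_field_def coords_uncoords)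

interpretation slit: smooth_atlas "slit N"
  by (rule smooth_atlas_slit)

abbreviation pi_in_chart :: "('a \<times> 'e \<Rightarrow> 'e) \<Rightarrow> ('a, 'e) chart \<Rightarrow> 'e \<times> 'e \<Rightarrow> 'e" where
  "pi_in_chart Z c \<equiv> (\<lambda>u. coords N c (fst u) (Z u)) \<circ> chart_inv (slit_chart N c)"

lemma slit_chart_charts: "c \<in> charts N \<Longrightarrow> slit_chart N c \<in> charts (slit N)"
  by (simp add: charts_slit)

lemma slit_pointsD:
  assumes "u \<in> points (slit N)"
  shows "fst u \<in> points N" "snd u \<noteq> 0" "chart_at N (fst u) \<in> charts N" "fst u \<in> fst (chart_at N (fst u))"
    "u \<in> fst (slit_chart N (chart_at N (fst u)))"
    "snd (slit_chart N (chart_at N (fst u))) u = (snd (chart_at N (fst u)) (fst u), snd u)"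
    "snd (slit_chart N (chart_at N (fst u))) u \<in> chart_image (slit_chart N (chart_at N (fst u)))"
    "chart_inv (slit_chart N (chart_at N (fst u))) (snd (slit_chart N (chart_at N (fst u))) u) = u"
proof -
  show p: "fst u \<in> points N" "snd u \<noteq> 0" using assms by (auto simp: points_slit)
  show c: "chart_at N (fst u) \<in> charts N" "fst u \<in> fst (chart_at N (fst u))"
    using chart_at_charts chart_at_mem p by auto
  show m: "u \<in> fst (slit_chart N (chart_at N (fst u)))"
    using slit.chart_at_mem[OF assms] by (simp add: chart_at_slit)
  show "snd (slit_chart N (chart_at N (fst u))) u = (snd (chart_at N (fst u)) (fst u), snd u)"
    using snd_slit_chart[of N "chart_at N (fst u)" "fst u" "snd u"] coords_self[OF p(1)] by simp
  show "snd (slit_chart N (chart_at N (fst u))) u \<in> chart_image (slit_chart N (chart_at N (fst u)))"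
    by (rule chart_image_mem[OF m])
  show "chart_inv (slit_chart N (chart_at N (fst u))) (snd (slit_chart N (chart_at N (fst u))) u) = u"
    by (rule slit.chart_inv_left[OF slit_chart_charts[OF c(1)] m])
qed

text \<open>In the preferred slit chart the fibre coordinate is the vector itself. This links
  \<open>finsler_metric\<close>, defined by plain derivatives in the fibre, to
  \<open>dir_deriv\<close> along vertical vectors of the slit bundle.\<close>

lemma smooth_fibre:
  assumes "smooth_fun (slit N) F" "p \<in> points N"
  shows "smooth_on (- {0}) (\<lambda>z. F (p, z))"
    and "y \<noteq> 0 \<Longrightarrow> frechet_derivative (\<lambda>z. F (p, z)) (at y) v = dir_deriv (slit N) F (p, y) (0, v)"
proof -
  let ?c = "chart_at N p"
  let ?F = "F \<circ> chart_inv (slit_chart N ?c)"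
  note c = chart_at_charts[OF assms(2)] chart_at_mem[OF assms(2)]
  have a: "snd ?c p \<in> chart_image ?c" by (rule chart_image_mem[OF c(2)])
  have eq: "?F (snd ?c p, z) = F (p, z)" if "z \<noteq> 0" for z
    by (simp add: slit_chart_inv[OF c(1) a that] chart_inv_left[OF c] uncoords_self[OF assms(2)])
  have o: "open (- {0::'e})" by (intro open_Compl closed_singleton)
  have s: "smooth_on (chart_image (slit_chart N ?c)) ?F"
    by (rule smooth_funD[OF assms(1) slit_chart_charts[OF c(1)]])
  show "smooth_on (- {0}) (\<lambda>z. F (p, z))"
    by (rule smooth_on_cong[OF smooth_on_compose[OF smooth_on_Pair[OF smooth_on_const[OF o, of "snd ?c p"]
              smooth_on_linear[OF o bounded_linear_ident]] s]])
      (use a eq in \<open>auto simp: slit_chart_image[OF c(1)]\<close>)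
  assume y: "y \<noteq> 0"
  have m: "(snd ?c p, y) \<in> chart_image (slit_chart N ?c)"
    using a y by (simp add: slit_chart_image[OF c(1)])
  have "((\<lambda>z. ?F (snd ?c p, z)) has_derivative (\<lambda>v. frechet_derivative ?F (at (snd ?c p, y)) (0, v))) (at y)"
    by (rule has_derivative_compose[where f="\<lambda>z. (snd ?c p, z)" and g="?F", OF _
          frechet_derivativeD[OF smooth_on_differentiable[OF s m]]])
      (auto intro!: derivative_eq_intros)
  then have "((\<lambda>z. F (p, z)) has_derivative (\<lambda>v. frechet_derivative ?F (at (snd ?c p, y)) (0, v))) (at y)"
    by (rule has_derivative_transform_within_open[OF _ o]) (use y eq in auto)
  then have "frechet_derivative (\<lambda>z. F (p, z)) (at y) v = frechet_derivative ?F (at (snd ?c p, y)) (0, v)"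
    by (simp add: frechet_derivative_eqI)
  then show "frechet_derivative (\<lambda>z. F (p, z)) (at y) v = dir_deriv (slit N) F (p, y) (0, v)"
    by (simp add: dir_deriv_def chart_at_slit snd_slit_chart coords_self[OF assms(2)])
qed

lemma field_in_slit_chart:
  assumes "c \<in> charts N" "x \<in> chart_image (slit_chart N c)"
  shows "fst (field_in_chart (slit N) V (slit_chart N c) x) = pi_in_chart (\<lambda>u. fst (V u)) c x"
    and "(\<And>u. u \<in> points (slit N) \<Longrightarrow> V u = (0, Z u)) \<Longrightarrow>
      field_in_chart (slit N) V (slit_chart N c) x = (0, pi_in_chart Z c x)"
  using slit_coords[OF assms(1) chart_inv_mem[OF assms(2)]] slit_chart_inv_points[OF assms]
  by (simp_all add: field_in_chart_def)

lemma field_in_own_slit_chart: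
  assumes "u \<in> points (slit N)"
  shows "field_in_chart (slit N) V (slit_chart N (chart_at N (fst u))) (snd (slit_chart N (chart_at N (fst u))) u) = V u"
  using slit.coords_self[OF assms]
  by (simp add: field_in_chart_def slit_pointsD(8)[OF assms] chart_at_slit)

lemma smooth_vector_field_vertical:
  assumes "smooth_pi_field N Z"
  shows "smooth_vector_field (slit N) (\<lambda>u. (0, Z u))"
  unfolding smooth_vector_field_def charts_slit
proof
  fix c' assume "c' \<in> slit_chart N ` charts N"
  then obtain c where c: "c \<in> charts N" and c': "c' = slit_chart N c" by blast
  show "smooth_on (chart_image c') (field_in_chart (slit N) (\<lambda>u. (0, Z u)) c')"
    unfolding c'
    by (rule smooth_on_cong[OF smooth_on_Pair[OF smooth_on_const[OF open_slit_chart_image[OF c], of 0]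
              smooth_pi_fieldD[OF assms c]]])
      (subst field_in_slit_chart(2)[OF c, of _ _ Z]; simp)
qed

end

text \<open>Inside the locale the topology of the manifold is present only through
  \<open>cutoffs\<close>, which \<open>cutoff_exists\<close> supplies.\<close>

locale cartan_finsler = smooth_atlas M
  for M :: "('a, 'e::euclidean_space) charted_space" +
  fixes L :: "'a \<times> 'e \<Rightarrow> real" and D :: "('a, 'e) pi_connection"
  assumes finsler: "finsler_structure M L" and cartan: "cartan_connection M L D"
    and cutoffs: "c \<in> charts M \<Longrightarrow> p \<in> fst c \<Longrightarrow>
      \<exists>\<psi> e. cutoff M c \<psi> \<and> e > 0 \<and> ball (snd c p) e \<subseteq> chart_image c \<and>
        (\<forall>x\<in>ball (snd c p) e. \<psi> (chart_inv c x) = 1)"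
begin

interpretation slit: smooth_atlas "slit M"
  by (rule smooth_atlas_slit)

section \<open>The energy and the Finsler metric\<close>

lemma conn: "linear_connection M D"
  using cartan by (simp add: cartan_connection_def regular_connection_def)

lemma L_pos: "u \<in> points (slit M) \<Longrightarrow> L u > 0"
  using finsler by (simp add: finsler_structure_def)

lemma L_smooth: "smooth_fun (slit M) L"
  using finsler by (simp add: finsler_structure_def)

definition energy :: "'a \<times> 'e \<Rightarrow> real" where
  "energy u = (L u)\<^sup>2 / 2"

lemma energy_smooth: "smooth_fun (slit M) energy"
  unfolding smooth_fun_def
proof
  fix c assume c: "c \<in> charts (slit M)"
  have "smooth_on (chart_image c) (\<lambda>x. (1 / 2) *\<^sub>R ((L \<circ> chart_inv c) x *\<^sub>R (L \<circ> chart_inv c) x))"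
    by (intro smooth_on_scaleR smooth_on_const slit.chart_open c smooth_funD[OF L_smooth c])
  then show "smooth_on (chart_image c) (energy \<circ> chart_inv c)"
    by (rule smooth_on_cong) (simp add: energy_def power2_eq_square)
qed

abbreviation dE :: "'a \<times> 'e \<Rightarrow> 'e \<Rightarrow> real" where
  "dE u \<equiv> frechet_derivative (\<lambda>z. energy (fst u, z)) (at (snd u))"

lemma finsler_metric_eq:
  "finsler_metric L u v w = frechet_derivative (\<lambda>y. dE (fst u, y) w) (at (snd u)) v"
  by (simp add: finsler_metric_def energy_def)

lemma energy_fibre: "p \<in> points M \<Longrightarrow> smooth_on (- {0}) (\<lambda>z. energy (p, z))"
  by (rule smooth_fibre(1)[OF energy_smooth])

lemma energy_homogeneous:
  assumes "p \<in> points M" "y \<noteq> 0" "t > 0"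
  shows "energy (p, t *\<^sub>R y) = t powr 2 * energy (p, y)"
proof -
  have "L (p, t *\<^sub>R y) = t * L (p, y)"
    using finsler assms by (auto simp: finsler_structure_def pos_homogeneous_def points_slit)
  then show ?thesis using assms by (simp add: energy_def power_mult_distrib)
qed

lemma dE_linear: "u \<in> points (slit M) \<Longrightarrow> linear (dE u)"
  using smooth_on_differentiable[OF energy_fibre[OF slit_pointsD(1)], of u "snd u"] slit_pointsD(2)[of u]
  by (intro linear_frechet_derivative) simp

lemma dE_differentiable:
  assumes "u \<in> points (slit M)"
  shows "(\<lambda>y. dE (fst u, y) w) differentiable (at (snd u))"
  using smooth_on_differentiable[OF smooth_on_derivative[OF energy_fibre], of "fst u" "snd u"] assms
  by (simp add: points_slit mem_Times_iff)

lemma metric_linear_left: "u \<in> points (slit M) \<Longrightarrow> linear (\<lambda>v. finsler_metric L u v w)"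
  unfolding finsler_metric_eq by (intro linear_frechet_derivative dE_differentiable)

text \<open>The first derivative of the energy is linear in \<open>w\<close> at every nonzero vector
  of the fibre; uniqueness of derivatives passes this on to its derivative in
  \<open>y\<close>.\<close>

lemma metric_linear_right:
  assumes u: "u \<in> points (slit M)"
  shows "linear (finsler_metric L u v)"
proof -
  have p: "fst u \<in> points M" "snd u \<noteq> 0" using slit_pointsD[OF u] by auto
  have lin: "linear (dE (fst u, y))" if "y \<in> - {0}" for y
    using dE_linear[of "(fst u, y)"] that p by (simp add: points_slit)
  have D: "((\<lambda>y. dE (fst u, y) w) has_derivative (\<lambda>v. finsler_metric L u v w)) (at (snd u))" for w
    using frechet_derivativeD[OF dE_differentiable[OF u]] by (simp add: finsler_metric_eq)
  show ?thesis
  proof (rule linearI)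
    fix a b
    have "((\<lambda>y. dE (fst u, y) (a + b)) has_derivative (\<lambda>v. finsler_metric L u v a + finsler_metric L u v b)) (at (snd u))"
      by (rule has_derivative_transform_within_open[OF has_derivative_add[OF D D], of "- {0}"])
        (use p linear_add[OF lin] in auto)
    from has_derivative_unique[OF D this]
    show "finsler_metric L u v (a + b) = finsler_metric L u v a + finsler_metric L u v b" by metis
  next
    fix k :: real and a
    have "((\<lambda>y. dE (fst u, y) (k *\<^sub>R a)) has_derivative (\<lambda>v. k *\<^sub>R finsler_metric L u v a)) (at (snd u))"
      by (rule has_derivative_transform_within_open[OF has_derivative_scaleR_right[OF D], of "- {0}"])
        (use p linear_cmul[OF lin] in auto)
    from has_derivative_unique[OF D this]
    show "finsler_metric L u v (k *\<^sub>R a) = k *\<^sub>R finsler_metric L u v a" by metis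
  qed
qed

lemma metric_pos: "u \<in> points (slit M) \<Longrightarrow> v \<noteq> 0 \<Longrightarrow> finsler_metric L u v v > 0"
  using finsler by (simp add: finsler_structure_def)

lemma metric_nondegenerate:
  assumes u: "u \<in> points (slit M)" and eq: "\<And>w. finsler_metric L u v w = finsler_metric L u v' w"
  shows "v = v'"
proof -
  have "finsler_metric L u (v - v') (v - v') = 0"
    using linear_diff[OF metric_linear_left[OF u]] eq by simp
  then show ?thesis using metric_pos[OF u, of "v - v'"] by fastforce
qed

lemma metric_eta:
  assumes u: "u \<in> points (slit M)"
  shows "finsler_metric L u (eta u) w = dE u w" "finsler_metric L u v (eta u) = dE u v"
proof -
  have p: "fst u \<in> points M" "snd u \<noteq> 0" using slit_pointsD[OF u] by auto
  note h = homogeneous_hessian[OF energy_fibre[OF p(1)] energy_homogeneous[OF p(1)] p(2)]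
  show "finsler_metric L u (eta u) w = dE u w"
    using h(1)[of w] by (simp add: finsler_metric_eq eta_def)
  show "finsler_metric L u v (eta u) = dE u v"
    using h(2)[of v] by (simp add: finsler_metric_eq eta_def)
qed

text \<open>\<open>G\<close> is the endomorphism that represents the metric with respect to the
  inner product of the model space; it is injective, hence surjective. Together with nondegeneracy
  this gives the description operator in \<open>grad\<close> its meaning.\<close>

lemma metric_represents:
  assumes u: "u \<in> points (slit M)" and "linear \<theta>"
  shows "\<exists>v. \<forall>w. finsler_metric L u v w = \<theta> w"
proof -
  define G where "G = (\<lambda>v. \<Sum>i\<in>Basis. finsler_metric L u v i *\<^sub>R i)"
  have Gi: "G v \<bullet> w = finsler_metric L u v w" for v w
    by (subst linear_basis_expansion[OF metric_linear_right[OF u], of v w])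
      (simp add: G_def inner_sum_left inner_sum_right inner_commute mult.commute)
  have "linear G"
    by (rule linearI)
      (simp_all add: G_def linear_add[OF metric_linear_left[OF u]] linear_cmul[OF metric_linear_left[OF u]]
        scaleR_add_left sum.distrib scaleR_sum_right)
  moreover have "inj G"
    using metric_nondegenerate[OF u] Gi by (intro injI) metis
  ultimately have "surj G" by (rule linear_injective_imp_surjective) simp
  then obtain v where "G v = (\<Sum>i\<in>Basis. \<theta> i *\<^sub>R i)" by (metis surjD)
  then have "finsler_metric L u v w = \<theta> w" for w
    using Gi[of v w] linear_basis_expansion[OF assms(2), of w]
    by (simp add: inner_sum_left inner_sum_right inner_commute mult.commute)
  then show ?thesis by blast
qed

section \<open>The connection map and horizontal lifts\<close>

abbreviation K :: "'a \<times> 'e \<Rightarrow> 'e \<times> 'e \<Rightarrow> 'e" where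
  "K \<equiv> conn_map D"

lemma K_linear: "u \<in> points (slit M) \<Longrightarrow> linear (K u)"
  unfolding conn_map_def[abs_def]
  using linear_connection_linear[OF conn _ smooth_pi_field_eta] by simp

lemma K_regular:
  assumes "u \<in> points (slit M)"
  shows "fst \<xi> = 0 \<Longrightarrow> K u \<xi> = 0 \<Longrightarrow> \<xi> = 0" "\<exists>h. K u h = 0 \<and> fst h = v"
proof -
  have v: "vertical M u \<inter> horizontal D u = {0}"
    "\<And>\<xi>. \<exists>v\<in>vertical M u. \<exists>h\<in>horizontal D u. \<xi> = v + h"
    using cartan assms by (auto simp: cartan_connection_def regular_connection_def)
  show "fst \<xi> = 0 \<Longrightarrow> K u \<xi> = 0 \<Longrightarrow> \<xi> = 0"
    using v(1) by (metis (mono_tags, lifting) IntI horizontal_def mem_Collect_eq rho_eq[OF assms] singletonD vertical_def)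
  \<comment> \<open>Any vector over \<open>v\<close> could be decomposed here: removing its vertical
    part leaves the base component unchanged.\<close>
  obtain w h where "fst w = 0" "K u h = 0" "(v, 0) = w + h"
    using v(2)[of "(v, 0)"] by (auto simp: vertical_def horizontal_def rho_eq[OF assms])
  then show "\<exists>h. K u h = 0 \<and> fst h = v"
    by (intro exI[of _ h]) (metis add_0 fst_add fst_conv)
qed

lemma beta:
  assumes u: "u \<in> points (slit M)"
  shows beta_unique: "K u \<xi> = 0 \<Longrightarrow> beta M D u (fst \<xi>) = \<xi>"
    and fst_beta: "fst (beta M D u v) = v" and K_beta: "K u (beta M D u v) = 0"
proof -
  have inj: "inj_on (rho M u) (horizontal D u)"
  proof (rule inj_onI)
    fix a b assume "a \<in> horizontal D u" "b \<in> horizontal D u" "rho M u a = rho M u b"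
    then have "fst (a - b) = 0" "K u (a - b) = 0"
      by (simp_all add: rho_eq[OF u] horizontal_def linear_diff[OF K_linear[OF u]])
    then show "a = b" using K_regular(1)[OF u] by fastforce
  qed
  show *: "beta M D u (fst \<xi>) = \<xi>" if "K u \<xi> = 0" for \<xi>
    using inv_into_f_f[OF inj, of \<xi>] that by (simp add: beta_def horizontal_def rho_eq[OF u])
  obtain h where "K u h = 0" "fst h = v" using K_regular(2)[OF u] by blast
  with *[of h] show "fst (beta M D u v) = v" "K u (beta M D u v) = 0" by auto
qed

lemma linear_beta:
  assumes u: "u \<in> points (slit M)"
  shows "linear (beta M D u)"
proof (rule linearI)
  show "beta M D u (a + b) = beta M D u a + beta M D u b" for a b
    using beta_unique[OF u, of "beta M D u a + beta M D u b"]
    by (simp add: linear_add[OF K_linear[OF u]] K_beta[OF u] fst_beta[OF u])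
  show "beta M D u (k *\<^sub>R a) = k *\<^sub>R beta M D u a" for k a
    using beta_unique[OF u, of "k *\<^sub>R beta M D u a"]
    by (simp add: linear_cmul[OF K_linear[OF u]] K_beta[OF u] fst_beta[OF u])
qed

text \<open>In a chart, \<open>\<beta>X\<close> solves the linear system \<open>fst \<xi> = X, K \<xi> = 0\<close>, whose coefficients are smooth.\<close>

lemma beta_field_differentiable:
  assumes u: "u \<in> points (slit M)" and X: "smooth_pi_field M X"
  defines "c \<equiv> chart_at M (fst u)"
  shows "field_in_chart (slit M) (\<lambda>w. beta M D w (X w)) (slit_chart M c)
    differentiable (at (snd (slit_chart M c) u))"
proof -
  let ?sc = "slit_chart M c" and ?p = "fst u"
  note u' = slit_pointsD[OF u, folded c_def]
  have c: "c \<in> charts M" and sc: "?sc \<in> charts (slit M)" using u' slit_chart_charts by auto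
  obtain \<psi> e where \<psi>: "cutoff M c \<psi>" "e > 0" "ball (snd c ?p) e \<subseteq> chart_image c"
    "\<And>x. x \<in> ball (snd c ?p) e \<Longrightarrow> \<psi> (chart_inv c x) = 1"
    using cutoffs[OF c u'(4)] by blast
  define S where "S = ball (snd c ?p) e \<times> (- {0::'e})"
  have S: "open S" "snd ?sc u \<in> S" "S \<subseteq> chart_image ?sc"
    using \<psi>(2,3) u' by (auto simp: S_def slit_chart_image[OF c] intro!: open_Times)
  let ?i = "chart_inv ?sc"
  have i: "?i x \<in> points (slit M)" "?i x \<in> fst ?sc" "fst (?i x) \<in> fst c" "\<psi> (fst (?i x)) = 1" "snd ?sc (?i x) = x"
    if "x \<in> S" for x
    using that S(3) slit_chart_inv_points[OF c, of x] chart_inv_mem[of x ?sc] chart_inv_right[of x ?sc]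
      slit_chart_inv'[OF c, of x] \<psi>(4)[of "fst x"]
    by (auto simp: fst_slit_chart S_def slit_chart_image[OF c])
  define Kc where "Kc = (\<lambda>x \<xi>. coords M c (fst (?i x)) (K (?i x) (uncoords (slit M) ?sc (?i x) \<xi>)))"
  \<comment> \<open>On \<open>S\<close> the cutoff is 1, so this is the coordinate expression of
    \<open>\<nabla>\<eta>\<close> along a globally smooth field, to which the smoothness clause of
    \<open>linear_connection\<close> applies.\<close>
  have "smooth_on S (\<lambda>x. Kc x \<xi>)" for \<xi>
  proof -
    let ?V = "const_field (slit M) ?sc (\<lambda>u. \<psi> (fst u)) \<xi>"
    have V: "smooth_vector_field (slit M) ?V"
      by (rule slit.const_field_smooth[OF sc cutoff_slit[OF c \<psi>(1)]])
    have "smooth_on S (pi_in_chart (\<lambda>u. D u (?V u) eta) c)"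
      by (rule smooth_on_subset[OF smooth_pi_fieldD[OF linear_connection_smooth[OF conn V smooth_pi_field_eta] c] S(1,3)])
    then show ?thesis
      by (rule smooth_on_cong) (simp add: Kc_def const_field_def conn_map_def i)
  qed
  then have dK: "(\<lambda>x. Kc x \<xi>) differentiable (at x)" if "x \<in> S" for x \<xi>
    using smooth_on_differentiable that by blast
  have lK: "linear (Kc x)" if "x \<in> S" for x
    using linear_compose[OF linear_compose[OF slit.linear_uncoords[OF sc i(2)[OF that]] K_linear[OF i(1)[OF that]]]
        linear_coords[OF c i(3)[OF that]]]
    by (simp add: Kc_def comp_def)
  define B where "B = (\<lambda>x \<xi>. (fst \<xi>, Kc x \<xi>))"
  define b where "b = field_in_chart (slit M) (\<lambda>w. beta M D w (X w)) ?sc"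
  have lB: "linear (B x)" if "x \<in> S" for x
    using lK[OF that] by (intro linearI) (simp_all add: B_def linear_add linear_cmul)
  have iB: "inj (B x)" if "x \<in> S" for x
  proof -
    \<comment> \<open>A kernel vector is vertical and horizontal at once, and regularity leaves only
      0.\<close>
    have "\<xi> = 0" if "B x \<xi> = 0" for \<xi>
    proof -
      let ?z = "uncoords (slit M) ?sc (?i x) \<xi>"
      note ix = i[OF \<open>x \<in> S\<close>]
      have "coords M c (fst (?i x)) (fst ?z) = fst \<xi>"
        using fst_slit_coords[OF c ix(2), of ?z] slit.coords_uncoords[OF sc ix(2), of \<xi>] by simp
      then have "fst ?z = 0" "K (?i x) ?z = 0"
        using that by (auto simp: B_def Kc_def coords_eq_0_iff[OF c ix(3)] zero_prod_def)
      then have "?z = 0" by (rule K_regular(1)[OF ix(1)])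
      then show ?thesis by (simp add: slit.uncoords_eq_0_iff[OF sc ix(2)])
    qed
    then show ?thesis using linear_injective_0[OF lB[OF that]] by blast
  qed
  have eq: "B x (b x) = (pi_in_chart X c x, 0)" if "x \<in> S" for x
  proof -
    note ix = i[OF that]
    have "uncoords (slit M) ?sc (?i x) (b x) = beta M D (?i x) (X (?i x))"
      by (simp add: b_def field_in_chart_def slit.uncoords_coords[OF sc ix(2)])
    then show ?thesis
      using field_in_slit_chart(1)[OF c, of x "\<lambda>w. beta M D w (X w)"] that S(3)
      by (auto simp: B_def Kc_def K_beta[OF ix(1)] linear_0[OF linear_coords[OF c ix(3)]] fst_beta[OF ix(1)] b_def)
  qed
  have "b differentiable (at (snd ?sc u))"
  proof (rule differentiable_linear_solution[OF S(1,2) _ lB iB eq])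
    show "(\<lambda>x. B x \<xi>) differentiable (at y)" if "y \<in> S" for y \<xi>
      using dK[OF that] by (simp add: B_def)
    have "pi_in_chart X c differentiable (at (snd ?sc u))"
      using S by (intro smooth_on_differentiable[OF smooth_pi_fieldD[OF X c]]) auto
    then show "(\<lambda>x. (pi_in_chart X c x, 0::'e)) differentiable (at (snd ?sc u))"
      by (intro differentiable_Pair differentiable_const)
  qed
  then show ?thesis by (simp add: b_def)
qed

section \<open>The mixed torsion and the connection map on vertical vectors\<close>

lemma lie_bracket_slit:
  "lie_bracket (slit M) V W u = (let c = slit_chart M (chart_at M (fst u)); x = snd c u;
     V' = field_in_chart (slit M) V c; W' = field_in_chart (slit M) W c
   in frechet_derivative W' (at x) (V' x) - frechet_derivative V' (at x) (W' x))"
  by (simp add: lie_bracket_def chart_at_slit)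

text \<open>\<open>\<rho> (\<gamma> X)\<close> vanishes identically, which removes the middle term
  of the torsion. It also means that the derivative of \<open>\<gamma> X\<close> contributes nothing
  to the base component of the bracket, so only the chart derivative of \<open>W\<close> along
  \<open>\<gamma> X\<close> remains.\<close>

lemma hv_torsion_eq:
  assumes u: "u \<in> points (slit M)" and X: "smooth_pi_field M X" and W: "smooth_pi_field M W"
  defines "c \<equiv> chart_at M (fst u)"
  shows "hv_torsion M D X W u
    = D u (0, X u) W - frechet_derivative (pi_in_chart W c) (at (snd (slit_chart M c) u)) (0, X u)"
proof -
  let ?sc = "slit_chart M c" and ?x = "snd (slit_chart M c) u"
  note u' = slit_pointsD[OF u, folded c_def]
  have c: "c \<in> charts M" by (rule u'(3))
  let ?V = "\<lambda>u. gam M u (X u)" and ?W = "\<lambda>u. beta M D u (W u)"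
  let ?V' = "field_in_chart (slit M) ?V ?sc" and ?W' = "field_in_chart (slit M) ?W ?sc"
  note o = open_slit_chart_image[OF c]
  have "D u (?V u) (\<lambda>w. rho M w (?W w)) = D u (0, X u) W"
    unfolding gam_eq[OF u]
    by (rule connection_cong[OF conn u, symmetric]) (simp_all add: W rho_eq fst_beta)
  moreover have "D u (?W u) (\<lambda>w. rho M w (?V w)) = 0"
    by (rule connection_0[OF conn u]) (simp add: rho_eq gam_eq)
  moreover have "fst (lie_bracket (slit M) ?V ?W u)
      = frechet_derivative (pi_in_chart W c) (at ?x) (0, X u)"
  proof -
    have V': "?V' x = (0, pi_in_chart X c x)" if "x \<in> chart_image ?sc" for x
      by (rule field_in_slit_chart(2)[OF c that gam_eq])
    have W': "fst (?W' x) = pi_in_chart W c x" if "x \<in> chart_image ?sc" for x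
      using field_in_slit_chart(1)[OF c that, of ?W] slit_chart_inv_points[OF c that]
      by (simp add: fst_beta)
    have dV: "?V' differentiable (at ?x)"
    proof -
      have "(\<lambda>x. (0::'e, pi_in_chart X c x)) differentiable (at ?x)"
        by (intro differentiable_Pair differentiable_const
            smooth_on_differentiable[OF smooth_pi_fieldD[OF X c] u'(7)])
      then show ?thesis
        using differentiable_cong_open[OF o u'(7), of ?V' "\<lambda>x. (0, pi_in_chart X c x)"] V' by blast
    qed
    have "fst (frechet_derivative ?V' (at ?x) h) = 0" for h
    proof -
      have "frechet_derivative (\<lambda>x. fst (?V' x)) (at ?x) = frechet_derivative (\<lambda>x. 0) (at ?x)"
        by (rule frechet_derivative_cong_open[OF o u'(7)]) (simp add: V')
      then show ?thesis by (simp add: fst_frechet_derivative[OF dV])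
    qed
    moreover have "fst (frechet_derivative ?W' (at ?x) h) = frechet_derivative (pi_in_chart W c) (at ?x) h" for h
    proof -
      have "frechet_derivative (\<lambda>x. fst (?W' x)) (at ?x) = frechet_derivative (pi_in_chart W c) (at ?x)"
        by (rule frechet_derivative_cong_open[OF o u'(7)]) (rule W')
      then show ?thesis
        by (simp only: fst_frechet_derivative[OF beta_field_differentiable[OF u W, folded c_def]])
    qed
    moreover have "?V' ?x = (0, X u)"
      using field_in_own_slit_chart[OF u, of ?V, folded c_def] gam_eq[OF u] by simp
    ultimately show ?thesis
      unfolding lie_bracket_slit c_def[symmetric] by (simp add: Let_def)
  qed
  ultimately show ?thesis
    by (simp add: hv_torsion_def torsion_def rho_eq[OF u])
qed

text \<open>Pullback of a base field that has constant components near the base point of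
  \<open>u\<close>. It extends a single vector to a global smooth field and, having zero chart
  derivative at \<open>u\<close>, isolates the connection term in
  \<open>hv_torsion_eq\<close>.\<close>

lemma const_pi_field:
  assumes u: "u \<in> points (slit M)"
  defines "c \<equiv> chart_at M (fst u)"
  shows "\<exists>V. smooth_pi_field M (\<lambda>w. V (fst w)) \<and> V (fst u) = z \<and>
    frechet_derivative (pi_in_chart (\<lambda>w. V (fst w)) c) (at (snd (slit_chart M c) u)) = (\<lambda>h. 0)"
proof -
  let ?sc = "slit_chart M c" and ?p = "fst u"
  note u' = slit_pointsD[OF u, folded c_def]
  have c: "c \<in> charts M" by (rule u'(3))
  obtain \<psi> e where \<psi>: "cutoff M c \<psi>" "e > 0" "ball (snd c ?p) e \<subseteq> chart_image c"
    "\<And>x. x \<in> ball (snd c ?p) e \<Longrightarrow> \<psi> (chart_inv c x) = 1"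
    using cutoffs[OF c u'(4)] by blast
  let ?V = "const_field M c \<psi> z"
  have "smooth_pi_field M (\<lambda>w. ?V (fst w))"
    by (rule smooth_pi_field_base[OF const_field_smooth[OF c \<psi>(1)]])
  moreover have "\<psi> ?p = 1"
    using \<psi>(2) \<psi>(4)[of "snd c ?p"] by (simp add: chart_inv_left[OF c u'(4)])
  then have "?V ?p = z"
    using const_field_value[OF u'(1)] by (simp add: c_def)
  moreover have "frechet_derivative (pi_in_chart (\<lambda>w. ?V (fst w)) c) (at (snd ?sc u))
      = frechet_derivative (\<lambda>x. z) (at (snd ?sc u))"
  proof (rule frechet_derivative_cong_open)
    show "open (ball (snd c ?p) e \<times> (- {0::'e}))" by (intro open_Times) auto
    show "snd ?sc u \<in> ball (snd c ?p) e \<times> (- {0})" using u' \<psi>(2) by simp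
    fix x :: "'e \<times> 'e" assume x: "x \<in> ball (snd c ?p) e \<times> (- {0})"
    then have m: "fst x \<in> chart_image c" "x \<in> chart_image c \<times> (- {0})" using \<psi>(3) by auto
    show "pi_in_chart (\<lambda>w. ?V (fst w)) c x = z"
      using x \<psi>(4)[of "fst x"]
      by (simp add: slit_chart_inv'[OF c m(2)] coords_const_field[OF c chart_inv_mem[OF m(1)]] mem_Times_iff)
  qed
  ultimately show ?thesis by (intro exI[of _ ?V]) simp
qed

text \<open>Compare the symmetry of the torsion in the pair \<open>(\<eta>, Z)\<close> with \<open>\<nabla>g = 0\<close> on the same pair, where
  \<open>Z\<close> is constant in a chart: the two unknown terms \<open>g(\<nabla>Z, \<eta>)\<close> cancel.\<close>

lemma K_vertical:
  assumes u: "u \<in> points (slit M)"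
  shows "K u (0, x) = x"
proof (rule metric_nondegenerate[OF u])
  fix z
  define c where "c = chart_at M (fst u)"
  let ?x = "snd (slit_chart M c) u"
  note u' = slit_pointsD[OF u, folded c_def]
  have c: "c \<in> charts M" by (rule u'(3))
  obtain X where X: "smooth_pi_field M X" "X u = x"
    using const_pi_field[OF u, of x] by blast
  obtain V where V: "smooth_pi_field M (\<lambda>w. V (fst w))" "V (fst u) = z"
    "frechet_derivative (pi_in_chart (\<lambda>w. V (fst w)) c) (at ?x) = (\<lambda>h. 0)"
    using const_pi_field[OF u, of z, folded c_def] by blast
  let ?Z = "\<lambda>w. V (fst w)"
  \<comment> \<open>In a slit chart \<open>\<eta>\<close> is the fibre coordinate, so its chart
    derivative along \<open>(0, x)\<close> is \<open>x\<close>.\<close>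
  have "frechet_derivative (pi_in_chart eta c) (at ?x) = frechet_derivative snd (at ?x)"
  proof (rule frechet_derivative_cong_open[OF open_slit_chart_image[OF c] u'(7)])
    fix y assume "y \<in> chart_image (slit_chart M c)"
    then show "pi_in_chart eta c y = snd y"
      by (cases y) (auto simp: slit_chart_image[OF c] slit_chart_inv[OF c] eta_def coords_uncoords[OF c] chart_inv_mem)
  qed
  also have "\<dots> = snd"
    by (intro frechet_derivative_eqI bounded_linear_imp_has_derivative bounded_linear_snd)
  finally have Teta: "hv_torsion M D X eta u = K u (0, x) - x"
    using hv_torsion_eq[OF u X(1) smooth_pi_field_eta, folded c_def] by (simp add: X(2) conn_map_def)
  have TZ: "hv_torsion M D X ?Z u = D u (0, x) ?Z"
    using hv_torsion_eq[OF u X(1) V(1), folded c_def] by (simp add: X(2) V(3))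
  have "finsler_metric L u (hv_torsion M D X eta u) (?Z u) = finsler_metric L u (hv_torsion M D X ?Z u) (eta u)"
    using cartan u X(1) V(1) smooth_pi_field_eta unfolding cartan_connection_def by blast
  then have 1: "finsler_metric L u (K u (0, x)) z - finsler_metric L u x z = dE u (D u (0, x) ?Z)"
    unfolding Teta TZ by (simp add: V(2) metric_eta[OF u] linear_diff[OF metric_linear_left[OF u]])
  have dEG: "dE w (V (fst w)) = dir_deriv (slit M) energy w (0, V (fst w))" if "w \<in> points (slit M)" for w
    using smooth_fibre(2)[OF energy_smooth slit_pointsD(1,2)[OF that]] by simp
  \<comment> \<open>\<open>g(\<eta>, Z)\<close> is the derivative of the energy along the vertical
    field of \<open>Z\<close>. Since \<open>Z\<close> is constant along each fibre, its further
    derivative in the direction \<open>(0, x)\<close> is the fibre Hessian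
    \<open>g(x, z)\<close>.\<close>
  let ?G = "\<lambda>w. dir_deriv (slit M) energy w (0, V (fst w))"
  have G: "smooth_fun (slit M) ?G"
    by (rule slit.smooth_fun_dir_deriv[OF energy_smooth smooth_vector_field_vertical[OF V(1)]])
  have "dir_deriv (slit M) (\<lambda>w. finsler_metric L w (eta w) (?Z w)) u (0, x) = dir_deriv (slit M) ?G u (0, x)"
    using slit.dir_deriv_cong[OF u, of "\<lambda>w. finsler_metric L w (eta w) (?Z w)" ?G]
    by (simp add: metric_eta dEG)
  also have "\<dots> = frechet_derivative (\<lambda>y. ?G (fst u, y)) (at (snd u)) x"
    using smooth_fibre(2)[OF G u'(1,2)] by simp
  also have "\<dots> = finsler_metric L u x z"
    unfolding finsler_metric_eq
    by (rule arg_cong[where f="\<lambda>F. F x"], rule frechet_derivative_cong_open[of "- {0}"])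
      (use u'(1,2) V(2) dEG in \<open>auto simp: points_slit\<close>)
  finally have 2: "dir_deriv (slit M) (\<lambda>w. finsler_metric L w (eta w) (?Z w)) u (0, x) = finsler_metric L u x z" .
  have "dir_deriv (slit M) (\<lambda>w. finsler_metric L w (eta w) (?Z w)) u (0, x)
      = finsler_metric L u (D u (0, x) eta) (?Z u) + finsler_metric L u (eta u) (D u (0, x) ?Z)"
    using cartan u V(1) smooth_pi_field_eta unfolding cartan_connection_def by blast
  then have "finsler_metric L u x z
      = finsler_metric L u (K u (0, x)) z + finsler_metric L u (eta u) (D u (0, x) ?Z)"
    unfolding 2 V(2) conn_map_def .
  \<comment> \<open>Combined with \<open>1\<close>, this says that
    \<open>2 * g(K u (0, x), z)\<close> equals \<open>2 * g(x, z)\<close>.\<close>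
  then show "finsler_metric L u (K u (0, x)) z = finsler_metric L u x z"
    using 1 by (simp add: metric_eta[OF u])
qed

end

subsection \<open>The horizontal Ricci identity and the conclusion\<close>

context smooth_atlas
begin

text \<open>Throughout the preferred chart of \<open>p\<close> the inner derivatives are the
  coordinate derivative of \<open>f\<close> applied to the coordinate field, which reduces the claim
  to \<open>bracket_second_derivative\<close>.\<close>

lemma dir_deriv_lie_bracket:
  fixes f :: "'a \<Rightarrow> real"
  assumes f: "smooth_fun N f" and p: "p \<in> points N"
    and V: "field_in_chart N V (chart_at N p) differentiable (at (snd (chart_at N p) p))"
    and W: "field_in_chart N W (chart_at N p) differentiable (at (snd (chart_at N p) p))"
  shows "dir_deriv N (\<lambda>w. dir_deriv N f w (W w)) p (V p) - dir_deriv N (\<lambda>w. dir_deriv N f w (V w)) p (W p)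
    = dir_deriv N f p (lie_bracket N V W p)"
proof -
  let ?c = "chart_at N p" and ?x = "snd (chart_at N p) p"
  let ?f = "f \<circ> chart_inv ?c"
  note c = chart_at_charts[OF p] chart_at_mem[OF p]
  note o = chart_open[OF c(1)] chart_image_mem[OF c(2)]
  have own: "field_in_chart N U ?c ?x = U p" for U
    by (simp add: field_in_chart_def chart_inv_left[OF c] coords_self[OF p])
  have D: "dir_deriv N (\<lambda>w. dir_deriv N f w (U w)) p
      = frechet_derivative (\<lambda>x. frechet_derivative ?f (at x) (field_in_chart N U ?c x)) (at ?x)" for U
    unfolding dir_deriv_def[of N "\<lambda>w. dir_deriv N f w (U w)"]
    by (rule frechet_derivative_cong_open[OF o]) (simp add: dir_deriv_field[OF f c(1)])
  show ?thesis
    using bracket_second_derivative[OF o smooth_on_Ck[OF smooth_funD[OF f c(1)]] V W]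
    by (simp only: D own lie_bracket_def dir_deriv_def[of N f p] Let_def)
qed

end

context cartan_finsler
begin

interpretation slit: smooth_atlas "slit M"
  by (rule smooth_atlas_slit)

text \<open>Both second-order terms of the curvature differentiate fields of the form
  \<open>K (\<beta> Z)\<close>, which vanish on the slit bundle. Only \<open>\<nabla>\<eta>\<close>
  along the bracket is left.\<close>

lemma R_hat_eq:
  assumes u: "u \<in> points (slit M)"
  shows "R_hat M D X Y u = K u (lie_bracket (slit M) (\<lambda>w. beta M D w (X w)) (\<lambda>w. beta M D w (Y w)) u)"
proof -
  have "D u \<xi> (\<lambda>w. D w (beta M D w (Z w)) eta) = 0" for \<xi> Z
    by (rule connection_0[OF conn u]) (use K_beta in \<open>simp add: conn_map_def\<close>)
  then show ?thesis
    by (simp add: R_hat_def h_curvature_def curvature_def conn_map_def)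
qed

lemma grad_metric:
  assumes f: "smooth_fun (slit M) f" and u: "u \<in> points (slit M)"
  shows "finsler_metric L u (grad M L D f u) w = dbar_fun M D f u w"
proof -
  have "linear (dbar_fun M D f u)"
    using linear_compose[OF linear_beta[OF u] slit.linear_dir_deriv[OF f u]]
    by (simp add: dbar_fun_def[abs_def] comp_def)
  then obtain v where v: "\<forall>w. finsler_metric L u v w = dbar_fun M D f u w"
    using metric_represents[OF u] by blast
  then have "\<forall>w. finsler_metric L u (grad M L D f u) w = dbar_fun M D f u w"
    unfolding grad_def by (rule theI) (use v metric_nondegenerate[OF u] in metis)
  then show ?thesis by blast
qed

lemma dbar_closed_grad_curvature:
  assumes f: "smooth_fun (slit M) f" and closed: "dbar_closed M L D (grad M L D f)"
    and X: "smooth_pi_field M X" and Y: "smooth_pi_field M Y" and u: "u \<in> points (slit M)"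
  shows "dir_deriv (slit M) f u (0, R_hat M D X Y u) = 0"
proof -
  let ?X = "\<lambda>w. beta M D w (X w)" and ?Y = "\<lambda>w. beta M D w (Y w)"
  let ?l = "lie_bracket (slit M) ?X ?Y u"
  have \<theta>: "dir_deriv (slit M) (\<lambda>w. finsler_metric L w (grad M L D f w) (Z w)) u
      = dir_deriv (slit M) (\<lambda>w. dir_deriv (slit M) f w (beta M D w (Z w))) u" for Z
    by (rule slit.dir_deriv_cong[OF u]) (simp add: grad_metric[OF f] dbar_fun_def)
  have "dbar_form M D (\<lambda>w. finsler_metric L w (grad M L D f w)) X Y u = 0"
    using closed X Y u by (simp add: dbar_closed_def)
  \<comment> \<open>The first two terms of \<open>dbar_form\<close> combine into the derivative
    along the whole bracket \<open>?l\<close>; the last one is the derivative along its horizontal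
    part.\<close>
  then have "dir_deriv (slit M) f u ?l - dir_deriv (slit M) f u (beta M D u (fst ?l)) = 0"
    using slit.dir_deriv_lie_bracket[OF f u, of ?X ?Y]
      beta_field_differentiable[OF u X] beta_field_differentiable[OF u Y]
    by (simp add: dbar_form_def \<theta> chart_at_slit grad_metric[OF f u] dbar_fun_def rho_eq[OF u])
  then have "dir_deriv (slit M) f u (?l - beta M D u (fst ?l)) = 0"
    by (simp add: linear_diff[OF slit.linear_dir_deriv[OF f u]])
  \<comment> \<open>This difference is the vertical part of the bracket. \<open>K_vertical\<close>
    recovers it from its image under \<open>K\<close>, and \<open>K\<close> kills the subtracted
    horizontal lift.\<close>
  moreover have "?l - beta M D u (fst ?l) = (0, R_hat M D X Y u)"
  proof -
    let ?v = "?l - beta M D u (fst ?l)"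
    have v: "?v = (0, snd ?v)" by (simp add: prod_eq_iff fst_beta[OF u])
    have "snd ?v = K u ?v" by (subst (2) v) (simp add: K_vertical[OF u])
    also have "\<dots> = R_hat M D X Y u"
      by (simp add: linear_diff[OF K_linear[OF u]] K_beta[OF u] R_hat_eq[OF u])
    finally show ?thesis using v by metis
  qed
  ultimately show ?thesis by simp
qed

section \<open>Vertical derivatives and scalar curvature\<close>

abbreviation vderiv :: "('a \<times> 'e \<Rightarrow> real) \<Rightarrow> 'a \<times> 'e \<Rightarrow> 'e \<Rightarrow> real" where
  "vderiv F u v \<equiv> dir_deriv (slit M) F u (0, v)"

lemma vderiv_fibre:
  assumes "smooth_fun (slit M) F" "u \<in> points (slit M)"
  shows "((\<lambda>z. F (fst u, z)) has_derivative vderiv F u) (at (snd u))"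
proof -
  have u: "fst u \<in> points M" "snd u \<noteq> 0" using slit_pointsD[OF assms(2)] by auto
  have "(\<lambda>z. F (fst u, z)) differentiable (at (snd u))"
    by (rule smooth_on_differentiable[OF smooth_fibre(1)[OF assms(1) u(1)]]) (use u in simp)
  moreover have "frechet_derivative (\<lambda>z. F (fst u, z)) (at (snd u)) = vderiv F u"
    using smooth_fibre(2)[OF assms(1) u] by (intro ext) simp
  ultimately show ?thesis by (metis frechet_derivativeD)
qed

lemma vderiv_linear: "smooth_fun (slit M) F \<Longrightarrow> u \<in> points (slit M) \<Longrightarrow> linear (vderiv F u)"
  using vderiv_fibre has_derivative_linear by blast

lemma vderiv_eta:
  assumes "smooth_fun (slit M) F" "pos_homogeneous M r F" "u \<in> points (slit M)"
  shows "vderiv F u (eta u) = r * F u"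
proof -
  note D = vderiv_fibre[OF assms(1,3)]
  have "frechet_derivative (\<lambda>z. F (fst u, z)) (at (snd u)) (snd u) = r * F (fst u, snd u)"
    by (rule homogeneous_euler)
      (use D assms(2,3) in \<open>auto simp: differentiable_def pos_homogeneous_def\<close>)
  then show ?thesis by (simp add: frechet_derivative_eqI[OF D] eta_def)
qed

text \<open>\<open>g(\<eta>, .)\<close> is the fibre differential of \<open>L\<^sup>2 / 2\<close>,
  that is \<open>L dL\<close>, and \<open>ell\<close> divides it by \<open>L\<close>.\<close>

lemma ell_eq:
  assumes u: "u \<in> points (slit M)"
  shows "ell L u v = vderiv L u v"
proof -
  have "((\<lambda>z. (L (fst u, z))\<^sup>2 / 2) has_derivative (\<lambda>v. L u * vderiv L u v)) (at (snd u))"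
    using vderiv_fibre[OF L_smooth u] by (auto intro!: derivative_eq_intros)
  then have "dE u v = L u * vderiv L u v"
    by (simp add: energy_def frechet_derivative_eqI)
  then show ?thesis
    using L_pos[OF u] by (simp add: ell_def metric_eta[OF u])
qed

lemma scalar_curvature_vderiv:
  assumes \<kappa>: "scalar_curvature M L D \<kappa>" "\<kappa> u \<noteq> 0"
    and f: "smooth_fun (slit M) f" "pos_homogeneous M r f" and closed: "dbar_closed M L D (grad M L D f)"
    and u: "u \<in> points (slit M)"
  shows "vderiv f u v = r * f u / L u * vderiv L u v"
proof -
  have pos: "L u > 0" by (rule L_pos[OF u])
  obtain V where V: "smooth_pi_field M (\<lambda>w. V (fst w))" "V (fst u) = v"
    using const_pi_field[OF u, of v] by blast
  have elleta: "ell L u (eta u) = L u"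
    using vderiv_eta[OF L_smooth _ u, of 1] finsler by (simp add: ell_eq[OF u] finsler_structure_def)
  \<comment> \<open>This removes the term of the wedge product in which \<open>\<phi>\<close> is
    evaluated at \<open>\<eta>\<close>.\<close>
  have phieta: "phi L u (eta u) = 0"
    using pos by (simp add: phi_def elleta)
  \<comment> \<open>Euler's theorem in degree 0. What remains of \<open>\<omega>(\<eta>)\<close> is
    \<open>1/3 * L * 3 * \<kappa> * L\<close>.\<close>
  have "vderiv \<kappa> u (eta u) = 0"
    using vderiv_eta[OF _ _ u, of \<kappa> 0] \<kappa> by (simp add: scalar_curvature_def)
  then have om: "omega M L \<kappa> u (eta u) = (L u)\<^sup>2 * \<kappa> u"
    by (simp add: omega_def d_J_def gam_eq[OF u] elleta power2_eq_square)
  have "R_hat M D eta (\<lambda>w. V (fst w)) u = ((L u)\<^sup>2 * \<kappa> u) *\<^sub>R phi L u v"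
    using \<kappa>(1) smooth_pi_field_eta V u by (simp add: scalar_curvature_def om phieta)
  then have "vderiv f u (((L u)\<^sup>2 * \<kappa> u) *\<^sub>R phi L u v) = 0"
    using dbar_closed_grad_curvature[OF f(1) closed smooth_pi_field_eta V(1) u] by simp
  then have "vderiv f u (phi L u v) = 0"
    using pos \<kappa>(2) by (simp add: linear_cmul[OF vderiv_linear[OF f(1) u]])
  \<comment> \<open>\<open>v\<close> differs from \<open>\<phi> v\<close> by the multiple
    \<open>\<ell>(v) / L\<close> of \<open>\<eta>\<close>, on which the vertical derivative of
    \<open>f\<close> is given by Euler's theorem.\<close>
  then show ?thesis
    using pos vderiv_eta[OF f u]
    by (simp add: phi_def ell_eq[OF u] linear_diff[OF vderiv_linear[OF f(1) u]]
        linear_cmul[OF vderiv_linear[OF f(1) u]] field_simps)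
qed

text \<open>On a line the punctured fibre would fall into two rays, with possibly different
  constants; \<open>dim\<close> excludes this.\<close>

lemma fibrewise_constant:
  assumes dim: "DIM('e) \<ge> 2" and f: "smooth_fun (slit M) f"
    and df: "\<And>u v. u \<in> points (slit M) \<Longrightarrow> vderiv f u v = r * f u / L u * vderiv L u v"
    and p: "p \<in> points M" and y: "y \<noteq> 0" "y' \<noteq> 0"
  shows "f (p, y) * L (p, y) powr (- r) = f (p, y') * L (p, y') powr (- r)"
proof (rule has_derivative_zero_unique_connected[where f="\<lambda>z. f (p, z) * L (p, z) powr (- r)" and s="- {0}"])
  show "open (- {0::'e})" by (intro open_Compl closed_singleton)
  show "connected (- {0::'e})" by (rule connected_punctured_universe[OF dim])
  fix z :: 'e assume "z \<in> - {0}"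
  then have u: "(p, z) \<in> points (slit M)" using p by (simp add: points_slit)
  have pos: "L (p, z) > 0" by (rule L_pos[OF u])
  have 1: "((\<lambda>x. x powr (- r)) has_derivative (*) (- r * L (p, z) powr (- r - 1))) (at (L (p, z)))"
    using has_real_derivative_powr[OF pos] by (simp only: has_field_derivative_def)
  have 2: "((\<lambda>z. L (p, z)) has_derivative vderiv L (p, z)) (at z)"
    using vderiv_fibre[OF L_smooth u] by simp
  from has_derivative_compose[OF 2 1] have Lr: "((\<lambda>z. L (p, z) powr (- r)) has_derivative
      (\<lambda>v. - r * L (p, z) powr (- r - 1) * vderiv L (p, z) v)) (at z)" .
  have ff: "((\<lambda>z. f (p, z)) has_derivative vderiv f (p, z)) (at z)"
    using vderiv_fibre[OF f u] by simp
  \<comment> \<open>In the product rule the term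
    \<open>- r f L\<^sup>-\<^sup>r\<^sup>-\<^sup>1 dL\<close> meets
    \<open>(r f / L) dL L\<^sup>-\<^sup>r\<close> from \<open>df\<close>.\<close>
  have "(\<lambda>v. f (p, z) * (- r * L (p, z) powr (- r - 1) * vderiv L (p, z) v)
      + vderiv f (p, z) v * L (p, z) powr (- r)) = (\<lambda>v. 0)"
    using pos by (simp add: df[OF u] powr_diff field_simps)
  then show "((\<lambda>z. f (p, z) * L (p, z) powr (- r)) has_derivative (\<lambda>v. 0)) (at z)"
    using has_derivative_mult[OF ff Lr] by metis
qed (use y in auto)

text \<open>\<open>p \<mapsto> (p, b)\<close> need not be a smooth section, because \<open>b\<close>
  is read in the preferred chart at \<open>p\<close> and that chart may jump. Fibrewise constancy
  allows \<open>b\<close> to be replaced, over each chart, by the vector whose components in that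
  chart are \<open>b\<close>; along this section the quotient is visibly smooth.\<close>

lemma smooth_base_factor:
  assumes f: "smooth_fun (slit M) f"
    and const: "\<And>p y y'. p \<in> points M \<Longrightarrow> y \<noteq> 0 \<Longrightarrow> y' \<noteq> 0 \<Longrightarrow>
      f (p, y) * L (p, y) powr (- r) = f (p, y') * L (p, y') powr (- r)"
  shows "\<exists>h. smooth_fun M h \<and> (\<forall>u\<in>points (slit M). f u = h (fst u) * L u powr r)"
proof -
  obtain b :: 'e where b: "b \<noteq> 0" using nonempty_Basis nonzero_Basis by blast
  define h where "h = (\<lambda>p. f (p, b) * L (p, b) powr (- r))"
  have "smooth_fun M h"
    unfolding smooth_fun_def
  proof
    fix c assume c: "c \<in> charts M"
    let ?i = "chart_inv (slit_chart M c)"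
    note o = chart_open[OF c]
    have pair: "smooth_on (chart_image c) (\<lambda>x. (x, b))"
      by (rule smooth_on_Pair[OF smooth_on_linear[OF o bounded_linear_ident] smooth_on_const[OF o]])
    have sub: "(\<lambda>x. (x, b)) ` chart_image c \<subseteq> chart_image (slit_chart M c)"
      using b by (auto simp: slit_chart_image[OF c])
    have F: "smooth_on (chart_image c) (\<lambda>x. (F \<circ> ?i) (x, b))" if "smooth_fun (slit M) F" for F :: "'a \<times> 'e \<Rightarrow> real"
      by (rule smooth_on_compose[OF pair smooth_funD[OF that slit_chart_charts[OF c]] sub])
    have pos: "(\<lambda>x. (L \<circ> ?i) (x, b)) ` chart_image c \<subseteq> {0<..}"
      using L_pos[OF slit_chart_inv_points[OF c]] sub by (simp add: image_subset_iff)
    show "smooth_on (chart_image c) (h \<circ> chart_inv c)"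
    proof (rule smooth_on_cong[OF smooth_on_scaleR[OF F[OF f]
              smooth_on_compose[OF F[OF L_smooth] smooth_on_powr[of "- r"] pos]]])
      fix x assume x: "x \<in> chart_image c"
      show "(f \<circ> ?i) (x, b) *\<^sub>R (L \<circ> ?i) (x, b) powr - r = (h \<circ> chart_inv c) x"
        \<comment> \<open>Exchange of the section with constant components in \<open>c\<close> for
          the vector \<open>b\<close> of the preferred chart, within one fibre.\<close>
        using const[OF chart_inv_points[OF c x], of "uncoords M c (chart_inv c x) b" b]
          uncoords_eq_0_iff[OF c chart_inv_mem[OF x]] b
        by (simp add: h_def slit_chart_inv[OF c x])
    qed
  qed
  moreover have "f u = h (fst u) * L u powr r" if u: "u \<in> points (slit M)" for u
  proof -
    have "h (fst u) = f u * L u powr (- r)"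
      using const[of "fst u" b "snd u"] slit_pointsD(1,2)[OF u] b by (simp add: h_def)
    then show ?thesis using L_pos[OF u] by (simp add: powr_minus)
  qed
  ultimately show ?thesis by blast
qed

end

theorem theorem2p11:
  fixes X :: "'a topology"
    and M :: "('a, 'e::euclidean_space) charted_space"
    and L \<kappa> f :: "'a \<times> 'e \<Rightarrow> real"
    and D :: "('a, 'e) pi_connection"
    and r :: real
  assumes "smooth_manifold X M" and "DIM('e) \<ge> 2"
    and "finsler_structure M L"
    and "cartan_connection M L D"
    and "scalar_curvature M L D \<kappa>"
    and "\<forall>u\<in>points (slit M). \<kappa> u \<noteq> 0"
    and "smooth_fun (slit M) f"
    and "\<forall>u\<in>points (slit M). f u \<noteq> 0"
    and "pos_homogeneous M r f"
    and "dbar_closed M L D (grad M L D f)"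
  shows "\<exists>h :: 'a \<Rightarrow> real. smooth_fun M h \<and>
           (\<forall>u\<in>points (slit M). f u = h (fst u) * L u powr r)"
proof -
  interpret cartan_finsler M L D
    by (intro cartan_finsler.intro smooth_manifold_atlas[OF assms(1)] cartan_finsler_axioms.intro
        assms(3,4) cutoff_exists[OF assms(1)])
  have "vderiv f u v = r * f u / L u * vderiv L u v" if "u \<in> points (slit M)" for u v
    using scalar_curvature_vderiv[OF assms(5) _ assms(7,9,10) that] assms(6) that by blast
  from fibrewise_constant[OF assms(2,7) this] show ?thesis
    by (intro smooth_base_factor assms(7))
qed

end
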